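(* Let $p$ be a prime, let $n\ge 0$ and $m\ge 1$ be integers with $p\nmid m$, and let $G$ be a finite group of order $p^nm$. Then $\psi_p(G)\leq\psi_p(C_{p^nm})$. Moreover, equality $\psi_p(G)=\psi_p(C_{p^nm})$ holds if and only if $G\cong H\rtimes C_{p^n}$ for some normal subgroup $H$ of $G$ of order $m$ (that is, $G$ is the semidirect product of a normal subgroup $H$ of order $m$ by a cyclic subgroup of order $p^n$).
   Context: $C_k$ denotes the cyclic group of order $k$, and $o(x)$ denotes the order of an element $x$. For a prime $p$, every element $x$ of a finite group $G$ can be written uniquely as $x=x_px_{p'}=x_{p'}x_p$ with commuting factors $x_p,x_{p'}\in G$, where $o(x_p)$ is a power of $p$ and $o(x_{p'})$ is not divisible by $p$; the element $x_p$ is called the $p$-part of $x$. Define $$\psi_p(G)=\sum_{x\in G}o(x_p).$$ *)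

theory Defs
  imports "HOL-Algebra.Multiplicative_Group" "HOL-Number_Theory.Cong"
begin

definition is_p_part :: "nat \<Rightarrow> ('a, 'b) monoid_scheme \<Rightarrow> 'a \<Rightarrow> 'a \<Rightarrow> bool" where
  "is_p_part p G x y \<longleftrightarrow>
     y \<in> carrier G \<and>
     (\<exists>z \<in> carrier G. x = y \<otimes>\<^bsub>G\<^esub> z \<and> x = z \<otimes>\<^bsub>G\<^esub> y \<and>
        (\<exists>k. group.ord G y = p ^ k) \<and> \<not> p dvd group.ord G z)"

text \<open>Existence and uniqueness of the decomposition, which the description in
  \<open>p_part\<close> below relies on.\<close>

lemma (in group) is_p_part_ex1:
  assumes "Factorial_Ring.prime p" "finite (carrier G)" "x \<in> carrier G"
  shows "\<exists>!y. is_p_part p G x y"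
proof -
  have pow_cong: "u [^] N = u" if "u \<in> carrier G" "[N = 1] (mod ord u)" for u and N :: nat
  proof -
    have "int (ord u) dvd 1 - int N"
      using that(2) by (metis cong_iff_dvd_diff cong_int_iff cong_sym int_ops(2))
    then have "u [^] int N = u [^] (1 :: int)"
      using that(1) int_pow_eq by blast
    then show ?thesis using that(1) by (simp add: int_pow_int)
  qed
  show ?thesis
  proof (rule ex_ex1I)
    have "ord x \<noteq> 0"
      using ord_ge_1[OF assms(2,3)] by simp
    then obtain q where q: "ord x = p ^ multiplicity p (ord x) * q" "\<not> p dvd q"
      using multiplicity_decompose'[of "ord x" p] assms(1) not_prime_unit by metis
    define a where "a = p ^ multiplicity p (ord x)"
    have a: "ord x = a * q" using q a_def by simp
    have cop: "coprime a q"
      using q(2) assms(1) by (simp add: a_def prime_imp_coprime)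
    obtain N where N: "[N = 1] (mod a)" "[N = 0] (mod q)"
      using binary_chinese_remainder_nat[OF cop] by blast
    obtain M where M: "[M = 0] (mod a)" "[M = 1] (mod q)"
      using binary_chinese_remainder_nat[OF cop] by blast
    have "[N + M = 1 + 0] (mod a)" "[N + M = 0 + 1] (mod q)"
      using N M by (intro cong_add; simp)+
    then have "[N + M = 1] (mod ord x)"
      using cop a coprime_cong_mult_nat by auto
    then have NM: "x [^] (N + M) = x"
      using assms(3) pow_cong by blast
    have qN: "q dvd N" and aM: "a dvd M"
      using N M by (simp_all add: cong_0_iff)
    have "(x [^] N) [^] a = \<one>"
      using assms(3) qN a by (simp add: nat_pow_pow pow_eq_id mult.commute mult_dvd_mono)
    then have "ord (x [^] N) dvd a"
      using assms(3) by (simp add: pow_eq_id)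
    then have k: "\<exists>k. ord (x [^] N) = p ^ k"
      using assms(1) divides_primepow_nat a_def by blast
    have "(x [^] M) [^] q = \<one>"
      using assms(3) aM a by (simp add: nat_pow_pow pow_eq_id mult_dvd_mono)
    then have "ord (x [^] M) dvd q"
      using assms(3) by (simp add: pow_eq_id)
    then have l: "\<not> p dvd ord (x [^] M)"
      using q(2) dvd_trans by blast
    have "x = x [^] N \<otimes> x [^] M" "x = x [^] M \<otimes> x [^] N"
      using NM assms(3) by (simp_all add: nat_pow_mult add.commute)
    then show "\<exists>y. is_p_part p G x y"
      unfolding is_p_part_def using k l assms(3) by (intro exI[of _ "x [^] N"]) blast
  next
    fix y y'
    assume "is_p_part p G x y" "is_p_part p G x y'"
    then obtain z z' k k' where
      y: "y \<in> carrier G" "z \<in> carrier G" "x = y \<otimes> z" "x = z \<otimes> y"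
        "ord y = p ^ k" "\<not> p dvd ord z" and
      y': "y' \<in> carrier G" "z' \<in> carrier G" "x = y' \<otimes> z'" "x = z' \<otimes> y'"
        "ord y' = p ^ k'" "\<not> p dvd ord z'"
      unfolding is_p_part_def by blast
    have "\<not> p dvd ord z * ord z'"
      using y(6) y'(6) assms(1) by (simp add: prime_dvd_mult_iff)
    then have "coprime (p ^ (k + k')) (ord z * ord z')"
      using assms(1) prime_imp_coprime coprime_power_left_iff by blast
    then obtain N where N: "[N = 1] (mod p ^ (k + k'))" "[N = 0] (mod ord z * ord z')"
      using binary_chinese_remainder_nat by blast
    have *: "x [^] N = u"
      if "u \<in> carrier G" "w \<in> carrier G" "x = u \<otimes> w" "x = w \<otimes> u"
        "ord u dvd p ^ (k + k')" "ord w dvd ord z * ord z'" for u w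
    proof -
      have "x [^] N = u [^] N \<otimes> w [^] N"
        using that by (metis pow_mult_distrib)
      moreover have "[N = 1] (mod ord u)"
        using N(1) that(5) cong_dvd_modulus_nat by blast
      then have "u [^] N = u"
        using that(1) pow_cong by blast
      moreover have "w [^] N = \<one>"
        using N(2) that(2,6) by (metis cong_0_iff dvd_trans pow_eq_id)
      ultimately show ?thesis using that(1) by simp
    qed
    show "y = y'"
      using *[of y z] *[of y' z'] y y' by (simp add: power_add)
  qed
qed

definition p_part :: "nat \<Rightarrow> ('a, 'b) monoid_scheme \<Rightarrow> 'a \<Rightarrow> 'a" where
  "p_part p G x = (THE y. is_p_part p G x y)"

definition psi :: "nat \<Rightarrow> ('a, 'b) monoid_scheme \<Rightarrow> nat" where
  "psi p G = (\<Sum>x \<in> carrier G. group.ord G (p_part p G x))"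

definition internal_semidirect_product ::
    "('a, 'b) monoid_scheme \<Rightarrow> 'a set \<Rightarrow> 'a set \<Rightarrow> bool" where
  "internal_semidirect_product G H K \<longleftrightarrow>
     H \<lhd> G \<and> subgroup K G \<and> H \<inter> K = {\<one>\<^bsub>G\<^esub>} \<and> H <#>\<^bsub>G\<^esub> K = carrier G"

end

theory Submission
  imports Defs "HOL-Algebra.Group_Action" "HOL-Algebra.Sylow" "HOL-Number_Theory.Totient"
begin

text \<open>
  Let \<open>N\<^sub>i\<close> be the number of solutions of \<open>x\<^bsup>p^i m\<^esup> = 1\<close> in \<open>G\<close>, that is, of \<open>x\<close> with
  \<open>o(x\<^sub>p) \<le> p\<^sup>i\<close>. Abel summation gives
  \<open>\<psi>\<^sub>p(G) = p\<^sup>n |G| - (\<Sum>i<n. (p\<^bsup>i+1\<^esup> - p\<^sup>i) N\<^sub>i)\<close>, and Frobenius' theorem gives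
  \<open>N\<^sub>i \<ge> p\<^sup>i m\<close>, which is an equality in the cyclic group. So \<open>\<psi>\<^sub>p\<close> is maximal iff
  \<open>N\<^sub>i = p\<^sup>i m\<close> for all \<open>i < n\<close>, as in every semidirect product \<open>H \<rtimes> C\<close> with \<open>C\<close> cyclic of
  order \<open>p\<^sup>n\<close>.

  Conversely, equality for \<open>i = n - 1\<close> yields a cyclic Sylow subgroup \<open>P\<close>, and counting the
  elements \<open>x\<close> with \<open>o(x\<^sub>p) = p\<^sup>n\<close> shows that distinct generators of \<open>P\<close> are not conjugate in \<open>G\<close>.
  With Sylow's theorem in the centralizer of an element \<open>u\<close> of order \<open>p\<close> in \<open>P\<close>, the only
  conjugate of \<open>u\<close> in \<open>P\<close> is \<open>u\<close> itself. Hence the transfer \<open>G \<rightarrow> P\<close> maps \<open>u\<close> to a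
  nontrivial element, so it is onto and its kernel is a normal complement of \<open>P\<close>.
\<close>

section \<open>Permutations of prime power period\<close>

lemma funpow_closed: "f \<in> S \<rightarrow> S \<Longrightarrow> x \<in> S \<Longrightarrow> (f ^^ i) x \<in> S"
  by (induction i) auto

lemma funpow_funpow: "(f ^^ i) ((f ^^ j) x) = (f ^^ (i + j)) x"
  by (simp add: funpow_add)

text \<open>If two of these iterates agree, then \<open>x\<close> has a period \<open>d\<close> with
  \<open>0 < d < p\<close>. As \<open>d\<close> is prime to \<open>p\<close>, Bezout's identity
  combines the periods \<open>d\<close> and \<open>p\<close> into the period 1, that is,
  \<open>f x = x\<close>.\<close>

lemma inj_on_funpow_prime_period:
  fixes p :: nat
  assumes "Factorial_Ring.prime p" "(f ^^ p) x = x" "f x \<noteq> x"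
  shows "inj_on (\<lambda>i. (f ^^ i) x) {..<p}"
proof -
  have period_mult: "(f ^^ (a * d)) x = x" if "(f ^^ d) x = x" for a d
    using that by (induction a) (simp_all add: funpow_add)
  have "False" if "i < j" "j < p" "(f ^^ i) x = (f ^^ j) x" for i j
  proof -
    have "(f ^^ (p - i)) ((f ^^ i) x) = x"
      using that(1,2) assms(2) by (simp add: funpow_funpow)
    moreover have "p - i + j = j - i + p" using that by simp
    then have "(f ^^ (p - i)) ((f ^^ j) x) = (f ^^ (j - i)) ((f ^^ p) x)"
      by (simp only: funpow_funpow)
    ultimately have d: "(f ^^ (j - i)) x = x"
      using that(3) assms(2) by simp
    have "gcd (j - i) p = 1"
      using prime_imp_coprime[OF assms(1), of "j - i"] that(1,2) nat_dvd_not_less[of "j - i" p]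
      by (simp add: coprime_iff_gcd_eq_1 gcd.commute)
    moreover have "j - i \<noteq> 0" using that(1) by simp
    ultimately obtain a b where "(j - i) * a = p * b + 1"
      using bezout_nat by metis
    then have "(f ^^ (a * (j - i))) x = f ((f ^^ (b * p)) x)"
      by (simp add: mult.commute)
    then show False
      using period_mult[OF d] period_mult[OF assms(2)] assms(3) by simp
  qed
  then show ?thesis
    unfolding inj_on_def by (metis lessThan_iff nat_neq_iff)
qed

text \<open>The points that \<open>f\<close> moves split into orbits of exactly \<open>p\<close>
  elements, and each orbit sum is divisible by \<open>M\<close>. The weight \<open>h\<close> lets
  the same argument serve for counting fixed points (\<open>h = 1\<close>, \<open>M = p\<close>) and
  for evaluating the transfer.\<close>

lemma dvd_sum_nonfixed:
  fixes h :: "'a \<Rightarrow> int"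
  assumes "Factorial_Ring.prime p" "finite S" "f \<in> S \<rightarrow> S"
    and period: "\<And>x. x \<in> S \<Longrightarrow> (f ^^ p) x = x"
    and orbit: "\<And>x. x \<in> S \<Longrightarrow> f x \<noteq> x \<Longrightarrow> M dvd (\<Sum>i<p. h ((f ^^ i) x))"
  shows "M dvd (\<Sum>x\<in>{x \<in> S. f x \<noteq> x}. h x)"
proof -
  define F where "F = {x \<in> S. f x \<noteq> x}"
  define orb where "orb x = (\<lambda>i. (f ^^ i) x) ` {..<p}" for x
  have p0: "p > 0" using assms(1) prime_gt_0_nat by blast
  have mem: "(f ^^ i) x \<in> orb x" if "x \<in> S" for x i
    unfolding orb_def using p0 funpow_mod_eq[OF period[OF that], of i]
    by (intro image_eqI[of _ _ "i mod p"]) simp_all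
  have card_orb: "card (orb x) = p" if "x \<in> F" for x
    using inj_on_funpow_prime_period[OF assms(1), of f x] that period
    by (simp add: F_def orb_def card_image)
  have F_closed: "(f ^^ i) x \<in> F" if "x \<in> F" "i < p" for x i
  proof -
    \<comment> \<open>Applying the remaining \<open>p - i\<close> iterates to a fixed iterate would
      make \<open>x\<close> itself fixed.\<close>
    have "f ((f ^^ i) x) \<noteq> (f ^^ i) x"
    proof
      assume "f ((f ^^ i) x) = (f ^^ i) x"
      then have "(f ^^ (p - i)) (f ((f ^^ i) x)) = (f ^^ (p - i)) ((f ^^ i) x)" by simp
      moreover have "(f ^^ (p - i)) ((f ^^ i) x) = (f ^^ p) x"
        using that by (simp add: funpow_funpow)
      moreover have "(f ^^ (p - i)) (f ((f ^^ i) x)) = f ((f ^^ p) x)"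
      proof -
        have "(f ^^ (p - i)) (f ((f ^^ i) x)) = (f ^^ (p - i + Suc i)) x"
          using funpow_funpow[of "p - i" f "Suc i" x] by simp
        also have "p - i + Suc i = Suc p" using that by simp
        finally show ?thesis by simp
      qed
      ultimately show False using that period by (auto simp: F_def)
    qed
    then show ?thesis
      using that funpow_closed[OF assms(3)] by (auto simp: F_def)
  qed
  have fibre: "{y \<in> F. orb y = orb x} = orb x" if x: "x \<in> F" for x
  proof
    show "{y \<in> F. orb y = orb x} \<subseteq> orb x"
      using mem[of _ 0] by (auto simp: F_def)
    show "orb x \<subseteq> {y \<in> F. orb y = orb x}"
    proof
      fix y assume "y \<in> orb x"
      then obtain i where i: "i < p" "y = (f ^^ i) x" by (auto simp: orb_def)
      then have y: "y \<in> F" using F_closed x by blast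
      \<comment> \<open>One inclusion is enough, because both orbits have \<open>p\<close>
        elements.\<close>
      have "orb y \<subseteq> orb x"
      proof
        fix w assume "w \<in> orb y"
        then obtain j where "w = (f ^^ (j + i)) x"
          using i by (auto simp: orb_def funpow_add)
        then show "w \<in> orb x" using mem x by (auto simp: F_def)
      qed
      then have "orb y = orb x"
        using card_orb[OF x] card_orb[OF y] by (intro card_subset_eq) (auto simp: orb_def)
      then show "y \<in> {y \<in> F. orb y = orb x}" using y by blast
    qed
  qed
  have "finite F" using assms(2) by (simp add: F_def)
  then have "(\<Sum>x\<in>F. h x) = (\<Sum>c\<in>orb ` F. \<Sum>x\<in>{x \<in> F. orb x = c}. h x)"
    by (rule sum.image_gen)
  moreover have "M dvd (\<Sum>x\<in>{y \<in> F. orb y = orb x}. h x)" if "x \<in> F" for x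
  proof -
    have "(\<Sum>x\<in>orb x. h x) = (\<Sum>i<p. h ((f ^^ i) x))"
      unfolding orb_def
      using inj_on_funpow_prime_period[OF assms(1), of f x] that period
      by (simp add: sum.reindex F_def)
    then show ?thesis
      using fibre[OF that] orbit that by (simp add: F_def)
  qed
  then have "M dvd (\<Sum>c\<in>orb ` F. \<Sum>x\<in>{x \<in> F. orb x = c}. h x)"
    by - (rule dvd_sum, auto)
  ultimately show ?thesis
    unfolding F_def[symmetric] by simp
qed

lemma card_fixed_cong_prime_period:
  assumes "Factorial_Ring.prime p" "finite S" "f \<in> S \<rightarrow> S"
    and "\<And>x. x \<in> S \<Longrightarrow> (f ^^ p) x = x"
  shows "[card S = card {x \<in> S. f x = x}] (mod p)"
proof -
  have "int p dvd (\<Sum>x\<in>{x \<in> S. f x \<noteq> x}. 1)"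
    by (rule dvd_sum_nonfixed[OF assms]) auto
  then have "p dvd card {x \<in> S. f x \<noteq> x}" by simp
  moreover have "card S = card {x \<in> S. f x = x} + card {x \<in> S. f x \<noteq> x}"
    using assms(2) by (subst card_Un_disjoint[symmetric]) (auto intro: arg_cong[where f = card])
  ultimately show ?thesis
    by (auto simp: cong_def)
qed

text \<open>Induction on \<open>k\<close>: the map \<open>f ^^ (p ^ k)\<close> has period
  \<open>p\<close>, so modulo \<open>p\<close> the set \<open>S\<close> may be replaced by its fixed
  points, on which \<open>f\<close> has period \<open>p ^ k\<close>.\<close>

lemma card_fixed_cong_prime_power_period:
  assumes "Factorial_Ring.prime p" "finite S" "f \<in> S \<rightarrow> S"
    and "\<And>x. x \<in> S \<Longrightarrow> (f ^^ (p ^ k)) x = x"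
  shows "[card S = card {x \<in> S. f x = x}] (mod p)"
  using assms(2-)
proof (induction k arbitrary: S)
  case 0
  then have "{x \<in> S. f x = x} = S" by auto
  then show ?case by simp
next
  case (Suc k)
  define g where "g = f ^^ (p ^ k)"
  define S' where "S' = {x \<in> S. g x = x}"
  have "[card S = card S'] (mod p)"
    unfolding S'_def
  proof (rule card_fixed_cong_prime_period[OF assms(1) Suc.prems(1)])
    show "g \<in> S \<rightarrow> S" using funpow_closed[OF Suc.prems(2)] by (auto simp: g_def)
    show "(g ^^ p) x = x" if "x \<in> S" for x
      using Suc.prems(3)[OF that] by (simp add: g_def funpow_mult mult.commute)
  qed
  also have "[card S' = card {x \<in> S'. f x = x}] (mod p)"
  proof (rule Suc.IH)
    show "f \<in> S' \<rightarrow> S'"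
      using Suc.prems(2) by (auto simp: S'_def g_def funpow_swap1[symmetric])
  qed (use Suc.prems(1) in \<open>auto simp: S'_def g_def\<close>)
  also have "{x \<in> S'. f x = x} = {x \<in> S. f x = x}"
  proof -
    have "(f ^^ i) x = x" if "f x = x" for i x
      using that by (induction i) auto
    then show ?thesis by (auto simp: S'_def g_def)
  qed
  finally show ?case .
qed

section \<open>Conjugacy, centralizers and \<open>p\<close>-parts\<close>

lemma ord_subgroup [simp]: "group.ord (G\<lparr>carrier := H\<rparr>) x = group.ord G x"
  if "group G" "subgroup H G"
proof -
  interpret group G by fact
  interpret H: group "G\<lparr>carrier := H\<rparr>" using that(2) by (rule subgroup_imp_group)
  show ?thesis
    unfolding H.ord_def ord_def by (simp flip: nat_pow_consistent)
qed

context group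
begin

definition centralizer :: "'a \<Rightarrow> 'a set" where
  "centralizer y = {x \<in> carrier G. x \<otimes> y = y \<otimes> x}"

definition conj_class :: "'a \<Rightarrow> 'a set" where
  "conj_class y = (\<lambda>g. g \<otimes> y \<otimes> inv g) ` carrier G"

definition p_regular :: "nat \<Rightarrow> 'a set" where
  "p_regular p = {x \<in> carrier G. \<not> p dvd ord x}"

lemma conj_eq_iff:
  assumes "g \<in> carrier G" "y \<in> carrier G" "z \<in> carrier G"
  shows "g \<otimes> y \<otimes> inv g = z \<longleftrightarrow> g \<otimes> y = z \<otimes> g"
  using assms by (metis inv_solve_right m_closed)

lemma centralizer_altdef:
  "y \<in> carrier G \<Longrightarrow> centralizer y = {g \<in> carrier G. g \<otimes> y \<otimes> inv g = y}"
  unfolding centralizer_def using conj_eq_iff[of _ y y] by blast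

lemma card_conj_class_mult_card_centralizer:
  assumes "y \<in> carrier G"
  shows "card (conj_class y) * card (centralizer y) = order G"
proof -
  interpret conj: group_action G "carrier G" "\<lambda>g. \<lambda>h\<in>carrier G. g \<otimes> h \<otimes> inv g"
    by (rule action_by_conjugation)
  have "orbit G (\<lambda>g. \<lambda>h\<in>carrier G. g \<otimes> h \<otimes> inv g) y = conj_class y"
    using assms by (auto simp: orbit_def conj_class_def)
  moreover have "stabilizer G (\<lambda>g. \<lambda>h\<in>carrier G. g \<otimes> h \<otimes> inv g) y = centralizer y"
    using assms by (auto simp: stabilizer_def centralizer_altdef)
  ultimately show ?thesis
    using conj.orbit_stabilizer_theorem[OF assms] by simp
qed

lemma conj_closed: "g \<in> carrier G \<Longrightarrow> y \<in> carrier G \<Longrightarrow> g \<otimes> y \<otimes> inv g \<in> carrier G"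
  by simp

lemma conj_conj:
  assumes "g \<in> carrier G" "h \<in> carrier G" "y \<in> carrier G"
  shows "g \<otimes> (h \<otimes> y \<otimes> inv h) \<otimes> inv g = (g \<otimes> h) \<otimes> y \<otimes> inv (g \<otimes> h)"
  using assms by (simp add: m_assoc inv_mult_group)

lemma conj_inv:
  assumes "g \<in> carrier G" "y \<in> carrier G"
  shows "inv g \<otimes> (g \<otimes> y \<otimes> inv g) \<otimes> inv (inv g) = y"
proof -
  have "inv g \<otimes> (g \<otimes> y) = y" using assms by (simp flip: m_assoc)
  then show ?thesis using assms by (simp add: m_assoc)
qed

lemma subgroup_centralizer:
  assumes "y \<in> carrier G"
  shows "subgroup (centralizer y) G"
proof
  fix a b assume "a \<in> centralizer y" "b \<in> centralizer y"
  then have ab: "a \<in> carrier G" "b \<in> carrier G" "a \<otimes> y = y \<otimes> a" "b \<otimes> y = y \<otimes> b"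
    by (auto simp: centralizer_def)
  then have "a \<otimes> (b \<otimes> y) = y \<otimes> a \<otimes> b"
    using assms by (simp flip: m_assoc ab(3) add: ab(4))
  then show "a \<otimes> b \<in> centralizer y"
    using ab assms by (simp add: centralizer_def m_assoc)
next
  fix a assume a: "a \<in> centralizer y"
  then show "inv a \<in> centralizer y"
    using assms conj_inv[of a y] by (simp add: centralizer_altdef)
qed (use assms in \<open>auto simp: centralizer_def\<close>)

lemma conj_mult:
  assumes "g \<in> carrier G" "x \<in> carrier G" "y \<in> carrier G"
  shows "g \<otimes> (x \<otimes> y) \<otimes> inv g = (g \<otimes> x \<otimes> inv g) \<otimes> (g \<otimes> y \<otimes> inv g)"
proof -
  have "inv g \<otimes> (g \<otimes> (y \<otimes> inv g)) = y \<otimes> inv g"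
    using assms by (simp flip: m_assoc)
  then show ?thesis using assms by (simp add: m_assoc)
qed

lemma conj_pow:
  assumes "g \<in> carrier G" "y \<in> carrier G"
  shows "(g \<otimes> y \<otimes> inv g) [^] (k :: nat) = g \<otimes> y [^] k \<otimes> inv g"
  using assms by (induction k) (simp_all add: conj_mult)

lemma ord_conj:
  assumes "g \<in> carrier G" "y \<in> carrier G"
  shows "ord (g \<otimes> y \<otimes> inv g) = ord y"
proof -
  have "(g \<otimes> y \<otimes> inv g) [^] k = \<one> \<longleftrightarrow> y [^] k = \<one>" for k :: nat
    using assms by (simp add: conj_pow conj_eq_iff)
  then show ?thesis
    unfolding ord_unique[OF conj_closed[OF assms]] pow_eq_id[OF assms(2), symmetric] by blast
qed

lemma conj_class_eq_iff:
  assumes "x \<in> carrier G" "y \<in> carrier G"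
  shows "conj_class x = conj_class y \<longleftrightarrow> x \<in> conj_class y"
proof
  have "\<one> \<otimes> x \<otimes> inv \<one> = x" using assms by simp
  then have "x \<in> conj_class x" unfolding conj_class_def by (intro image_eqI[of _ _ \<one>]) simp_all
  then show "x \<in> conj_class y" if "conj_class x = conj_class y"
    using that by simp
next
  have sub: "conj_class a \<subseteq> conj_class b" if "a \<in> conj_class b" "b \<in> carrier G" for a b
  proof -
    obtain h where "h \<in> carrier G" "a = h \<otimes> b \<otimes> inv h"
      using \<open>a \<in> conj_class b\<close> by (auto simp: conj_class_def)
    then show ?thesis
      using that(2) by (auto simp: conj_class_def conj_conj)
  qed
  assume x: "x \<in> conj_class y"
  then obtain h where "h \<in> carrier G" "x = h \<otimes> y \<otimes> inv h" by (auto simp: conj_class_def)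
  then have "y \<in> conj_class x"
    using assms(2) conj_inv[of h y] unfolding conj_class_def
    by (intro image_eqI[of _ _ "inv h"]) simp_all
  then show "conj_class x = conj_class y"
    using sub x assms by blast
qed

text \<open>Conjugate elements have the same class, so the orbit-stabilizer relation gives
  centralizers of equal order.\<close>

lemma card_centralizer_conj:
  assumes "finite (carrier G)" "g \<in> carrier G" "y \<in> carrier G"
  shows "card (centralizer (g \<otimes> y \<otimes> inv g)) = card (centralizer y)"
proof -
  have "conj_class (g \<otimes> y \<otimes> inv g) = conj_class y"
    using assms by (subst conj_class_eq_iff) (auto simp: conj_class_def)
  moreover have "order G > 0" using assms(1) order_gt_0_iff_finite by blast
  moreover have "card (conj_class (g \<otimes> y \<otimes> inv g)) * card (centralizer (g \<otimes> y \<otimes> inv g)) = order G"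
    using assms by (intro card_conj_class_mult_card_centralizer) simp
  moreover have "card (conj_class y) * card (centralizer y) = order G"
    using assms by (intro card_conj_class_mult_card_centralizer)
  ultimately show ?thesis
    by (metis mult_left_cancel mult_0 less_irrefl)
qed

text \<open>\<open>Y\<close> is a union of conjugacy classes and \<open>f\<close> is constant on
  each, so the sum splits into the terms \<open>card (conj_class y) * f y\<close>. It is applied to
  the number of \<open>p\<close>-regular elements centralizing \<open>y\<close>.\<close>

lemma dvd_sum_conj_invariant:
  fixes f :: "'a \<Rightarrow> nat"
  assumes "finite (carrier G)" "Y \<subseteq> carrier G"
    and closed: "\<And>g y. g \<in> carrier G \<Longrightarrow> y \<in> Y \<Longrightarrow> g \<otimes> y \<otimes> inv g \<in> Y"
    and invariant: "\<And>g y. g \<in> carrier G \<Longrightarrow> y \<in> Y \<Longrightarrow> f (g \<otimes> y \<otimes> inv g) = f y"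
    and "\<And>y. y \<in> Y \<Longrightarrow> m dvd card (conj_class y) * f y"
  shows "m dvd (\<Sum>y\<in>Y. f y)"
proof -
  have "finite Y" using assms(1,2) finite_subset by blast
  then have "(\<Sum>y\<in>Y. f y) = (\<Sum>c\<in>conj_class ` Y. \<Sum>x\<in>{x \<in> Y. conj_class x = c}. f x)"
    by (rule sum.image_gen)
  moreover have "m dvd (\<Sum>x\<in>{x \<in> Y. conj_class x = conj_class y}. f x)" if y: "y \<in> Y" for y
  proof -
    have yG: "y \<in> carrier G" using y assms(2) by blast
    have "conj_class y \<subseteq> Y" using closed[OF _ y] by (auto simp: conj_class_def)
    then have "{x \<in> Y. conj_class x = conj_class y} = conj_class y"
      using conj_class_eq_iff[OF _ yG] assms(2) by blast
    moreover have "(\<Sum>x\<in>conj_class y. f x) = (\<Sum>x\<in>conj_class y. f y)"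
      using invariant[OF _ y] by (intro sum.cong) (auto simp: conj_class_def)
    ultimately show ?thesis using assms(5)[OF y] by simp
  qed
  then have "m dvd (\<Sum>c\<in>conj_class ` Y. \<Sum>x\<in>{x \<in> Y. conj_class x = c}. f x)"
    by - (rule dvd_sum, auto)
  ultimately show ?thesis by simp
qed

section \<open>Fibres of the \<open>p\<close>-part map\<close>

lemma p_part_is_p_part:
  assumes "Factorial_Ring.prime p" "finite (carrier G)" "x \<in> carrier G"
  shows "is_p_part p G x (p_part p G x)"
  unfolding p_part_def using is_p_part_ex1[OF assms] by (rule theI')

lemma p_part_eq_iff:
  assumes "Factorial_Ring.prime p" "finite (carrier G)" "x \<in> carrier G"
  shows "p_part p G x = y \<longleftrightarrow> is_p_part p G x y"
  using is_p_part_ex1[OF assms] p_part_is_p_part[OF assms] by metis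

lemma is_p_part_mult:
  assumes "y \<in> carrier G" "ord y = p ^ k" "z \<in> centralizer y \<inter> p_regular p"
  shows "is_p_part p G (y \<otimes> z) y"
  using assms by (auto simp: is_p_part_def centralizer_def p_regular_def intro!: bexI[of _ z])

text \<open>By uniqueness of the decomposition, an element with \<open>p\<close>-part
  \<open>y\<close> is determined by its other factor, which can be any \<open>p\<close>-regular
  element commuting with \<open>y\<close>.\<close>

lemma p_part_fibre:
  assumes "Factorial_Ring.prime p" "finite (carrier G)" "y \<in> carrier G" "ord y = p ^ k"
  shows "{x \<in> carrier G. p_part p G x = y} = (\<lambda>z. y \<otimes> z) ` (centralizer y \<inter> p_regular p)"
proof (intro equalityI subsetI)
  fix x assume "x \<in> {x \<in> carrier G. p_part p G x = y}"
  then have "is_p_part p G x y" using p_part_eq_iff assms by auto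
  then show "x \<in> (\<lambda>z. y \<otimes> z) ` (centralizer y \<inter> p_regular p)"
    unfolding is_p_part_def centralizer_def p_regular_def by auto
next
  fix x assume "x \<in> (\<lambda>z. y \<otimes> z) ` (centralizer y \<inter> p_regular p)"
  then obtain z where z: "z \<in> centralizer y \<inter> p_regular p" "x = y \<otimes> z" by blast
  then have "x \<in> carrier G" using assms by (auto simp: centralizer_def)
  then show "x \<in> {x \<in> carrier G. p_part p G x = y}"
    using is_p_part_mult[OF assms(3,4) z(1)] z p_part_eq_iff[OF assms(1,2)] by auto
qed

text \<open>Left multiplication by \<open>y\<close> is injective, so the fibre over \<open>y\<close>
  has as many elements as \<open>centralizer y \<inter> p_regular p\<close>; the fibres are
  disjoint. All later counts of elements by their \<open>p\<close>-part go through this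
  formula.\<close>

lemma card_p_part_vimage:
  assumes "Factorial_Ring.prime p" "finite (carrier G)" "Y \<subseteq> carrier G"
    and "\<And>y. y \<in> Y \<Longrightarrow> \<exists>k. ord y = p ^ k"
  shows "card {x \<in> carrier G. p_part p G x \<in> Y} = (\<Sum>y\<in>Y. card (centralizer y \<inter> p_regular p))"
proof -
  have "finite Y" using assms finite_subset by blast
  have "{x \<in> carrier G. p_part p G x \<in> Y} = (\<Union>y\<in>Y. {x \<in> carrier G. p_part p G x = y})"
    by auto
  also have "card \<dots> = (\<Sum>y\<in>Y. card {x \<in> carrier G. p_part p G x = y})"
    by (rule card_UN_disjoint) (use \<open>finite Y\<close> assms(2) in auto)
  also have "\<dots> = (\<Sum>y\<in>Y. card (centralizer y \<inter> p_regular p))"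
  proof (rule sum.cong)
    fix y assume "y \<in> Y"
    then obtain k where "ord y = p ^ k" "y \<in> carrier G" using assms by blast
    moreover from this have "inj_on (\<lambda>z. y \<otimes> z) (centralizer y \<inter> p_regular p)"
      by (auto simp: inj_on_def centralizer_def)
    ultimately show "card {x \<in> carrier G. p_part p G x = y} = card (centralizer y \<inter> p_regular p)"
      using p_part_fibre[OF assms(1,2)] by (simp add: card_image)
  qed simp
  finally show ?thesis .
qed

lemma centralizer_conj_regular:
  assumes "g \<in> carrier G" "y \<in> carrier G"
  shows "(\<lambda>x. g \<otimes> x \<otimes> inv g) ` (centralizer y \<inter> p_regular p)
    \<subseteq> centralizer (g \<otimes> y \<otimes> inv g) \<inter> p_regular p"
  using assms
  by (auto simp: centralizer_def p_regular_def ord_conj simp flip: conj_mult)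

text \<open>Conjugation by \<open>g\<close> injects one set into the other; conjugation by
  \<open>inv g\<close> gives the reverse inequality.\<close>

lemma card_centralizer_regular_conj:
  assumes "finite (carrier G)" "g \<in> carrier G" "y \<in> carrier G"
  shows "card (centralizer (g \<otimes> y \<otimes> inv g) \<inter> p_regular p) = card (centralizer y \<inter> p_regular p)"
proof -
  have le: "card (centralizer y \<inter> p_regular p) \<le> card (centralizer (g \<otimes> y \<otimes> inv g) \<inter> p_regular p)"
    if "g \<in> carrier G" "y \<in> carrier G" for g y
  proof (rule card_inj_on_le)
    show "inj_on (\<lambda>x. g \<otimes> x \<otimes> inv g) (centralizer y \<inter> p_regular p)"
      using that by (auto simp: inj_on_def p_regular_def)
    show "finite (centralizer (g \<otimes> y \<otimes> inv g) \<inter> p_regular p)"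
      using assms(1) by (simp add: p_regular_def)
  qed (rule centralizer_conj_regular[OF that])
  from le[OF assms(2,3)] le[OF inv_closed[OF assms(2)] conj_closed[OF assms(2,3)]]
  show ?thesis using conj_inv[OF assms(2,3)] by simp
qed

text \<open>By Cauchy's theorem, obtained here from Sylow's theorem with exponent 1, some element
  has order \<open>q\<close>; its order is also a power of \<open>p\<close>.\<close>

lemma prime_dvd_order_p_group:
  assumes "finite (carrier G)" "Factorial_Ring.prime p" "\<And>x. x \<in> carrier G \<Longrightarrow> \<exists>k. ord x = p ^ k"
    and "Factorial_Ring.prime q" "q dvd order G"
  shows "q = p"
proof -
  have "\<exists>H. subgroup H G \<and> card H = q ^ 1"
    by (rule sylow_thm[of q G 1 "order G div q"]) (use assms is_group in auto)
  then obtain H where H: "subgroup H G" "card H = q" by auto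
  interpret H: group "G\<lparr>carrier := H\<rparr>" using H(1) by (rule subgroup_imp_group)
  have "H \<noteq> {\<one>}" using H(2) assms(4) by auto
  then obtain h where h: "h \<in> H" "h \<noteq> \<one>"
    using subgroup.one_closed[OF H(1)] by blast
  then have hG: "h \<in> carrier G" using subgroup.mem_carrier[OF H(1)] by blast
  have "ord h dvd q"
    using H.ord_dvd_group_order[of h] h H ord_subgroup[OF is_group H(1)] by (simp add: order_def)
  then have ord: "ord h = q"
    using assms(4) h(2) ord_eq_1[OF hG] by (auto simp: prime_nat_iff)
  obtain k where "ord h = p ^ k" using assms(3)[OF hG] by blast
  then have "q dvd p ^ k" using ord by (metis dvd_refl)
  then have "q dvd p" by (rule prime_dvd_power[OF assms(4)])
  then show ?thesis using primes_dvd_imp_eq[OF assms(4,2)] by blast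
qed

text \<open>The central \<open>p\<close>-elements form a subgroup all of whose elements have
  \<open>p\<close>-power order, so \<open>p\<close> is the only prime that can divide its order, and
  \<open>p\<close> does not divide \<open>b\<close>.\<close>

lemma coprime_card_central_p_elements:
  assumes "finite (carrier G)" "Factorial_Ring.prime p" "\<not> p dvd b"
  shows "coprime b (card {y \<in> carrier G. (\<exists>k. ord y = p ^ k) \<and> centralizer y = carrier G})"
proof -
  define Z where "Z = {y \<in> carrier G. (\<exists>k. ord y = p ^ k) \<and> centralizer y = carrier G}"
  have comm: "x \<otimes> y = y \<otimes> x" if "x \<in> carrier G" "y \<in> Z" for x y
    using that by (auto simp: Z_def centralizer_def)
  have Z: "subgroup Z G"
  proof
    show "\<one> \<in> Z" by (auto simp: Z_def centralizer_def intro: exI[of _ 0])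
  next
    fix x y assume xy: "x \<in> Z" "y \<in> Z"
    then obtain k l where "ord x = p ^ k" "ord y = p ^ l" by (auto simp: Z_def)
    moreover have "ord (x \<otimes> y) dvd ord x * ord y"
      using xy comm by (intro ord_mul_divides) (auto simp: Z_def)
    ultimately have "ord (x \<otimes> y) dvd p ^ (k + l)" by (simp add: power_add)
    then have "\<exists>k. ord (x \<otimes> y) = p ^ k" using divides_primepow_nat assms(2) by blast
    moreover have "centralizer (x \<otimes> y) = carrier G"
    proof -
      have "g \<otimes> (x \<otimes> y) = x \<otimes> y \<otimes> g" if "g \<in> carrier G" for g
        using that xy comm[OF that] by (metis (no_types, lifting) Z_def m_assoc mem_Collect_eq)
      then show ?thesis by (auto simp: centralizer_def)
    qed
    ultimately show "x \<otimes> y \<in> Z" using xy by (simp add: Z_def)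
  next
    fix x assume x: "x \<in> Z"
    then have xG: "x \<in> carrier G" by (simp add: Z_def)
    have "g \<otimes> inv x = inv x \<otimes> g" if "g \<in> carrier G" for g
    proof -
      have "g \<in> centralizer x" using that x by (simp add: Z_def)
      have "x \<in> centralizer g" using comm[OF that x] xG by (simp add: centralizer_def)
      then have "inv x \<in> centralizer g"
        using subgroup.m_inv_closed[OF subgroup_centralizer[OF that]] by blast
      then show ?thesis by (simp add: centralizer_def)
    qed
    then show "inv x \<in> Z" using x by (auto simp: Z_def centralizer_def)
  qed (auto simp: Z_def)
  interpret Z: group "G\<lparr>carrier := Z\<rparr>" using Z by (rule subgroup_imp_group)
  have "\<not> (q dvd b \<and> q dvd card Z)" if "Factorial_Ring.prime q" for q
  proof
    assume q: "q dvd b \<and> q dvd card Z"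
    have "q = p"
    proof (rule Z.prime_dvd_order_p_group[OF _ assms(2) _ that])
      show "finite (carrier (G\<lparr>carrier := Z\<rparr>))" using assms(1) by (simp add: Z_def)
      show "\<exists>k. Z.ord x = p ^ k" if "x \<in> carrier (G\<lparr>carrier := Z\<rparr>)" for x
        using that ord_subgroup[OF is_group Z] by (auto simp: Z_def)
      show "q dvd order (G\<lparr>carrier := Z\<rparr>)" using q by (simp add: order_def)
    qed
    then show False using q assms(3) by blast
  qed
  then have "gcd b (card Z) = 1"
    using prime_factor_nat[of "gcd b (card Z)"] by fastforce
  then show ?thesis
    by (simp add: Z_def coprime_iff_gcd_eq_1)
qed

end

section \<open>Frobenius' theorem for the exponents \<open>p\<^sup>i m\<close>\<close>

lemma p_regular_subgroup:
  assumes "group G" "subgroup H G"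
  shows "group.p_regular (G\<lparr>carrier := H\<rparr>) p = H \<inter> group.p_regular G p"
proof -
  interpret group G by fact
  interpret H: group "G\<lparr>carrier := H\<rparr>" using assms(2) by (rule subgroup_imp_group)
  show ?thesis
    using subgroup.subset[OF assms(2)] ord_subgroup[OF assms]
    by (auto simp: H.p_regular_def p_regular_def)
qed

context group
begin

text \<open>Orbit-stabilizer shows that \<open>b\<close> divides the class size times
  \<open>b'\<close>, the part of the centralizer order prime to \<open>p\<close>. The last
  hypothesis is the divisibility for the centralizer; it can be supplied by an induction hypothesis
  or by the finished result \<open>dvd_card_p_regular\<close>.\<close>

lemma dvd_card_conj_class_mult_regular:
  assumes "Factorial_Ring.prime p" "order G = p ^ a * b" "\<not> p dvd b" "y \<in> carrier G"
    and "order G \<noteq> 0"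
    and "\<And>a' b'. card (centralizer y) = p ^ a' * b' \<Longrightarrow> \<not> p dvd b' \<Longrightarrow>
      b' dvd card (centralizer y \<inter> p_regular p)"
  shows "b dvd card (conj_class y) * card (centralizer y \<inter> p_regular p)"
proof -
  have eq: "card (conj_class y) * card (centralizer y) = p ^ a * b"
    using card_conj_class_mult_card_centralizer[OF assms(4)] assms(2) by simp
  then have "card (centralizer y) \<noteq> 0" using assms(2,5) by (metis mult_0_right)
  then obtain a' b' where C: "card (centralizer y) = p ^ a' * b'" "\<not> p dvd b'"
    using multiplicity_decompose'[of "card (centralizer y)" p] assms(1) not_prime_unit by metis
  have "b dvd (card (conj_class y) * b') * p ^ a'"
    by (metis C(1) dvd_triv_right eq mult.assoc mult.commute)
  moreover have "coprime b (p ^ a')"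
    using prime_imp_coprime[OF assms(1,3)] by (simp add: coprime_commute)
  ultimately have "b dvd card (conj_class y) * b'"
    by (simp add: coprime_dvd_mult_left_iff)
  also have "\<dots> dvd card (conj_class y) * card (centralizer y \<inter> p_regular p)"
    using assms(6)[OF C] by (intro mult_dvd_mono) auto
  finally show ?thesis .
qed

end

text \<open>The case of Frobenius' theorem for the exponent \<open>b\<close>: the class sum over the
  noncentral \<open>p\<close>-elements is divisible by \<open>b\<close> by induction, and the number of central
  \<open>p\<close>-elements is prime to \<open>b\<close>.\<close>

lemma dvd_card_p_regular:
  fixes G :: "('a, 'b) monoid_scheme"
  assumes "Factorial_Ring.prime p" "group G" "finite (carrier G)" "order G = p ^ a * b" "\<not> p dvd b"
  shows "b dvd card (group.p_regular G p)"
  using assms(2-)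
proof (induction "order G" arbitrary: G a b rule: less_induct)
  case less
  interpret group G by fact
  have order: "order G \<noteq> 0" using less.prems(2) order_gt_0_iff_finite by auto
  define Y where "Y = {y \<in> carrier G. \<exists>k. ord y = p ^ k}"
  define Z where "Z = {y \<in> carrier G. (\<exists>k. ord y = p ^ k) \<and> centralizer y = carrier G}"
  define f where "f y = card (centralizer y \<inter> p_regular p)" for y
  have "finite Y" "Z \<subseteq> Y" using less.prems(2) by (auto simp: Y_def Z_def)
  have "p_part p G x \<in> Y" if "x \<in> carrier G" for x
    using p_part_is_p_part[OF assms(1) less.prems(2) that] by (auto simp: is_p_part_def Y_def)
  \<comment> \<open>Every element has its \<open>p\<close>-part in \<open>Y\<close>, so summing over
    the fibres gives the order of \<open>G\<close>.\<close>
  then have "{x \<in> carrier G. p_part p G x \<in> Y} = carrier G" by auto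
  moreover have "card {x \<in> carrier G. p_part p G x \<in> Y} = (\<Sum>y\<in>Y. f y)"
    unfolding f_def by (rule card_p_part_vimage[OF assms(1) less.prems(2)]) (auto simp: Y_def)
  ultimately have "order G = (\<Sum>y\<in>Y. f y)"
    by (simp add: order_def)
  also have "\<dots> = (\<Sum>y\<in>Y - Z. f y) + (\<Sum>y\<in>Z. f y)"
    using \<open>Z \<subseteq> Y\<close> \<open>finite Y\<close> by (rule sum.subset_diff)
  also have "(\<Sum>y\<in>Z. f y) = card Z * card (p_regular p)"
  proof -
    have "f y = card (p_regular p)" if "y \<in> Z" for y
    proof -
      have "centralizer y \<inter> p_regular p = p_regular p"
        using that by (auto simp: Z_def p_regular_def)
      then show ?thesis by (simp add: f_def)
    qed
    then show ?thesis by simp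
  qed
  finally have sum: "p ^ a * b = (\<Sum>y\<in>Y - Z. f y) + card Z * card (p_regular p)"
    using less.prems(3) by simp
  have "b dvd (\<Sum>y\<in>Y - Z. f y)"
  proof (rule dvd_sum_conj_invariant[OF less.prems(2)])
    fix g y assume g: "g \<in> carrier G" and y: "y \<in> Y - Z"
    then have yG: "y \<in> carrier G" by (simp add: Y_def)
    show "f (g \<otimes>\<^bsub>G\<^esub> y \<otimes>\<^bsub>G\<^esub> inv\<^bsub>G\<^esub> g) = f y"
      unfolding f_def by (rule card_centralizer_regular_conj[OF less.prems(2) g yG])
    \<comment> \<open>Conjugation preserves noncentrality, since it preserves the order of the
      centralizer.\<close>
    have "centralizer (g \<otimes>\<^bsub>G\<^esub> y \<otimes>\<^bsub>G\<^esub> inv\<^bsub>G\<^esub> g) \<noteq> carrier G"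
    proof
      assume "centralizer (g \<otimes>\<^bsub>G\<^esub> y \<otimes>\<^bsub>G\<^esub> inv\<^bsub>G\<^esub> g) = carrier G"
      then have "card (centralizer y) = card (carrier G)"
        using card_centralizer_conj[OF less.prems(2) g yG] by simp
      then have "centralizer y = carrier G"
        using less.prems(2) by (intro card_subset_eq) (auto simp: centralizer_def)
      then show False using y by (auto simp: Y_def Z_def)
    qed
    then show "g \<otimes>\<^bsub>G\<^esub> y \<otimes>\<^bsub>G\<^esub> inv\<^bsub>G\<^esub> g \<in> Y - Z"
      using g y yG by (auto simp: Y_def Z_def ord_conj)
  next
    fix y assume y: "y \<in> Y - Z"
    then have yG: "y \<in> carrier G" by (simp add: Y_def)
    let ?C = "G\<lparr>carrier := centralizer y\<rparr>"
    have C: "subgroup (centralizer y) G" by (rule subgroup_centralizer[OF yG])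
    have sub: "centralizer y \<subset> carrier G"
      using y by (auto simp: Y_def Z_def centralizer_def)
    show "b dvd card (conj_class y) * f y"
      unfolding f_def
    proof (rule dvd_card_conj_class_mult_regular[OF assms(1) less.prems(3,4) yG order])
      fix a' b' assume *: "card (centralizer y) = p ^ a' * b'" "\<not> p dvd b'"
      have "b' dvd card (group.p_regular ?C p)"
      proof (rule less.hyps)
        show "order ?C < order G"
          using psubset_card_mono[OF less.prems(2) sub] by (simp add: order_def)
        show "group ?C" using C by (rule subgroup_imp_group)
        show "finite (carrier ?C)" using sub less.prems(2) finite_subset by auto
        show "order ?C = p ^ a' * b'" using * by (simp add: order_def)
      qed (rule *(2))
      then show "b' dvd card (centralizer y \<inter> p_regular p)"
        using p_regular_subgroup[OF is_group C] by simp
    qed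
  qed (auto simp: Y_def)
  then have "b dvd card Z * card (p_regular p)"
    using sum by (metis dvd_add_right_iff dvd_triv_right)
  then show ?case
    using coprime_card_central_p_elements[OF less.prems(2) assms(1) less.prems(4)]
    by (simp add: Z_def coprime_dvd_mult_right_iff)
qed

text \<open>Write \<open>d = u * v\<close> with \<open>u\<close> dividing \<open>p ^ Suc j\<close>
  and \<open>v\<close> dividing \<open>m\<close>. If \<open>u\<close> were a smaller power of
  \<open>p\<close>, then \<open>d\<close> would divide \<open>p ^ j * m\<close>.\<close>

lemma prime_power_dvd_of_dvd_Suc:
  fixes p :: nat
  assumes "Factorial_Ring.prime p" "d dvd p ^ Suc j * m" "\<not> d dvd p ^ j * m"
  shows "p ^ Suc j dvd d"
proof -
  obtain u v where uv: "d = u * v" "u dvd p ^ Suc j" "v dvd m"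
    using division_decomp[OF assms(2)] by blast
  then obtain k where k: "k \<le> Suc j" "u = p ^ k"
    using divides_primepow_nat[OF assms(1)] by blast
  have "k = Suc j"
  proof (rule ccontr)
    assume "k \<noteq> Suc j"
    then have "u dvd p ^ j" using k by (simp add: le_imp_power_dvd)
    then show False using uv assms(3) by (simp add: mult_dvd_mono)
  qed
  then show ?thesis using uv k by simp
qed

section \<open>Cyclic subgroups and their generators\<close>

context group
begin

text \<open>Natural exponents suffice in a finite group, where this is the cyclic subgroup generated
  by \<open>x\<close>.\<close>

definition powers :: "'a \<Rightarrow> 'a set" where
  "powers x = range (\<lambda>k::nat. x [^] k)"

lemma powers_subset: "x \<in> carrier G \<Longrightarrow> powers x \<subseteq> carrier G"
  by (auto simp: powers_def)

lemma self_in_powers: "x \<in> carrier G \<Longrightarrow> x \<in> powers x"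
  unfolding powers_def by (intro image_eqI[of _ _ 1]) simp_all

lemma powers_mono:
  assumes "x \<in> carrier G" "y \<in> powers x"
  shows "powers y \<subseteq> powers x"
  using assms by (auto simp: powers_def nat_pow_pow)

lemma generate_eq_powers:
  assumes "finite (carrier G)" "x \<in> carrier G"
  shows "generate G {x} = powers x"
  using generate_pow_nat[OF assms(2)] ord_ge_1[OF assms]
  by (simp add: powers_def full_SetCompr_eq)

lemma card_powers:
  assumes "finite (carrier G)" "x \<in> carrier G"
  shows "card (powers x) = ord x"
  using generate_pow_card[OF assms(2)] generate_eq_powers[OF assms] by simp

lemma subgroup_powers:
  assumes "finite (carrier G)" "x \<in> carrier G"
  shows "subgroup (powers x) G"
  using generate_is_subgroup[of "{x}"] generate_eq_powers[OF assms] assms(2) by simp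

lemma powers_eq_iff:
  assumes "finite (carrier G)" "x \<in> carrier G" "y \<in> carrier G"
  shows "powers y = powers x \<longleftrightarrow> y \<in> powers x \<and> ord y = ord x"
proof
  show "y \<in> powers x \<and> ord y = ord x" if "powers y = powers x"
    using that self_in_powers[OF assms(3)] card_powers[OF assms(1,2)] card_powers[OF assms(1,3)]
    by simp
  show "powers y = powers x" if "y \<in> powers x \<and> ord y = ord x"
  proof (rule card_subset_eq)
    show "finite (powers x)" using powers_subset[OF assms(2)] assms(1) finite_subset by blast
  qed (use that powers_mono[OF assms(2)] card_powers[OF assms(1)] assms in auto)
qed

text \<open>The generators are the powers \<open>x [^] k\<close> with \<open>k\<close> prime to
  \<open>ord x\<close>, and \<open>k\<close> is unique in the range from 1 to
  \<open>ord x\<close>.\<close>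

lemma card_generators:
  assumes "finite (carrier G)" "x \<in> carrier G"
  shows "card {y \<in> carrier G. powers y = powers x} = totient (ord x)"
proof -
  have "{y \<in> carrier G. powers y = powers x} = (\<lambda>k. x [^] k) ` totatives (ord x)" (is "?A = ?B")
  proof (intro equalityI subsetI)
    fix y assume "y \<in> ?A"
    then have y: "y \<in> powers x" "ord y = ord x" using powers_eq_iff[OF assms] by auto
    then obtain k :: nat where k: "y = x [^] k" by (auto simp: powers_def)
    \<comment> \<open>\<open>totatives\<close> uses representatives from 1 to \<open>ord x\<close>,
      so the residue 0 becomes \<open>ord x\<close>; this occurs when
      \<open>ord x = 1\<close>.\<close>
    define l where "l = (if k mod ord x = 0 then ord x else k mod ord x)"
    have pos: "ord x > 0" using ord_ge_1[OF assms] by simp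
    have "[k = l] (mod ord x)" by (simp add: l_def cong_def)
    then have "y = x [^] l"
      using k assms(2) by (metis cong_iff_dvd_diff cong_int_iff cong_sym int_pow_eq int_pow_int)
    moreover have "coprime l (ord x)"
      using y(2) pow_ord_eq_ord_iff[OF assms] calculation by simp
    moreover have "0 < l" "l \<le> ord x"
      using pos by (auto simp: l_def intro: less_imp_le)
    ultimately show "y \<in> ?B" by (auto simp: in_totatives_iff)
  next
    fix y assume "y \<in> ?B"
    then obtain k where k: "y = x [^] k" "coprime k (ord x)" by (auto simp: in_totatives_iff)
    then have "y \<in> carrier G" "ord y = ord x" "y \<in> powers x"
      using assms pow_ord_eq_ord_iff[OF assms] by (auto simp: powers_def)
    then show "y \<in> ?A" using powers_eq_iff[OF assms] by simp
  qed
  moreover have "inj_on (\<lambda>k. x [^] k) (totatives (ord x))"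
    using ord_inj'[OF assms(2)] by (rule inj_on_subset) (auto simp: in_totatives_iff)
  ultimately show ?thesis by (simp add: card_image totient_def)
qed

text \<open>Group the elements by the cyclic subgroup that they generate. Generators of one subgroup
  have equal order, so the set is a union of such groups, each of size
  \<open>totient (ord x)\<close>.\<close>

lemma dvd_card_ord_in:
  assumes "finite (carrier G)" "\<And>x. x \<in> carrier G \<Longrightarrow> ord x \<in> D \<Longrightarrow> t dvd totient (ord x)"
  shows "t dvd card {x \<in> carrier G. ord x \<in> D}"
proof -
  define A where "A = {x \<in> carrier G. ord x \<in> D}"
  have fibre: "{y \<in> A. powers y = powers x} = {y \<in> carrier G. powers y = powers x}" if x: "x \<in> A" for x
  proof -
    have "y \<in> A" if "y \<in> carrier G" "powers y = powers x" for y
      using powers_eq_iff[OF assms(1), of x y] that x by (simp add: A_def)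
    then show ?thesis by (auto simp: A_def)
  qed
  have "finite A" using assms(1) by (simp add: A_def)
  then have "card A = (\<Sum>c\<in>powers ` A. card {y \<in> A. powers y = c})"
    using sum.image_gen[of A "\<lambda>_. 1::nat" powers] by simp
  moreover have "t dvd card {y \<in> A. powers y = powers x}" if "x \<in> A" for x
    using that assms card_generators[of x] by (simp add: fibre[OF that]) (simp add: A_def)
  then have "t dvd (\<Sum>c\<in>powers ` A. card {y \<in> A. powers y = c})"
    by - (rule dvd_sum, auto)
  ultimately show ?thesis by (simp add: A_def)
qed

end

section \<open>Solution counts \<open>N\<^sub>i\<close> and the formula for
  \<open>psi\<close>\<close>

locale p_m_group = group +
  fixes p n m :: nat
  assumes prime: "Factorial_Ring.prime p" and coprime: "\<not> p dvd m"
    and finite: "finite (carrier G)" and order: "order G = p ^ n * m"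
begin

definition num :: "nat \<Rightarrow> nat" where
  "num i = card {x \<in> carrier G. ord x dvd p ^ i * m}"

lemma p_regular_ord_dvd:
  assumes "x \<in> carrier G" "\<not> p dvd ord x"
  shows "ord x dvd m"
proof -
  have "ord x dvd p ^ n * m" using ord_dvd_group_order[OF assms(1)] order by simp
  moreover have "coprime (ord x) (p ^ n)"
    using prime_imp_coprime[OF prime assms(2)] by (simp add: coprime_commute)
  ultimately show ?thesis by (simp add: coprime_dvd_mult_right_iff)
qed

text \<open>For the last claim, the factor of \<open>x\<close> of order prime to \<open>p\<close>
  has order dividing \<open>m\<close>, so the exponent \<open>p ^ i * m\<close> kills it and only a
  condition on the \<open>p\<close>-part remains.\<close>

lemma ord_p_part:
  assumes "x \<in> carrier G"
  shows "p_part p G x \<in> carrier G" "\<exists>k\<le>n. ord (p_part p G x) = p ^ k"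
    "ord (p_part p G x) dvd p ^ i \<longleftrightarrow> ord x dvd p ^ i * m"
proof -
  obtain z k where *: "p_part p G x \<in> carrier G" "z \<in> carrier G"
    "x = p_part p G x \<otimes> z" "p_part p G x \<otimes> z = z \<otimes> p_part p G x"
    "ord (p_part p G x) = p ^ k" "\<not> p dvd ord z"
    using p_part_is_p_part[OF prime finite assms] unfolding is_p_part_def by metis
  show "p_part p G x \<in> carrier G" by fact
  have cop: "coprime (p ^ j) m" for j using prime coprime by (simp add: prime_imp_coprime)
  have "p ^ k dvd p ^ n * m" using ord_dvd_group_order[OF *(1)] order *(5) by simp
  then have "p ^ k dvd p ^ n" using cop by (simp add: coprime_dvd_mult_left_iff)
  then show "\<exists>k\<le>n. ord (p_part p G x) = p ^ k"
    using *(5) prime prime_gt_1_nat power_dvd_imp_le by blast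
  have z: "z [^] (p ^ i * m) = \<one>" using p_regular_ord_dvd[OF *(2,6)] pow_eq_id[OF *(2)] by simp
  have "ord x dvd p ^ i * m \<longleftrightarrow> p_part p G x [^] (p ^ i * m) \<otimes> z [^] (p ^ i * m) = \<one>"
    using pow_eq_id[OF assms] pow_mult_distrib[OF *(4,1,2)] *(3) by metis
  also have "\<dots> \<longleftrightarrow> ord (p_part p G x) dvd p ^ i * m"
    using z *(1) pow_eq_id[OF *(1)] by simp
  also have "\<dots> \<longleftrightarrow> ord (p_part p G x) dvd p ^ i"
    using cop *(5) by (simp add: coprime_dvd_mult_left_iff)
  finally show "ord (p_part p G x) dvd p ^ i \<longleftrightarrow> ord x dvd p ^ i * m" by simp
qed

lemma num_top: "num n = p ^ n * m"
proof -
  have "{x \<in> carrier G. ord x dvd p ^ n * m} = carrier G"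
    using ord_dvd_group_order order by auto
  then show ?thesis using order by (simp add: num_def order_def)
qed

lemma num_Suc:
  "num (Suc i) = num i + card {x \<in> carrier G. ord x dvd p ^ Suc i * m \<and> \<not> ord x dvd p ^ i * m}"
proof -
  have "d dvd p * p ^ i * m" if "d dvd p ^ i * m" for d
    using that by (metis dvd_mult mult.assoc)
  then have "{x \<in> carrier G. ord x dvd p ^ Suc i * m} = {x \<in> carrier G. ord x dvd p ^ i * m}
    \<union> {x \<in> carrier G. ord x dvd p ^ Suc i * m \<and> \<not> ord x dvd p ^ i * m}" by auto
  then show ?thesis
    unfolding num_def using finite by (simp add: card_Un_disjoint disjoint_iff)
qed

lemma layer_eq:
  "{x \<in> carrier G. ord x dvd p ^ Suc i * m \<and> \<not> ord x dvd p ^ i * m}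
    = {x \<in> carrier G. p_part p G x \<in> {y \<in> carrier G. ord y = p ^ Suc i}}"
proof -
  have "ord x dvd p ^ Suc i * m \<and> \<not> ord x dvd p ^ i * m \<longleftrightarrow> ord (p_part p G x) = p ^ Suc i"
    if x: "x \<in> carrier G" for x
  proof -
    obtain k where k: "ord (p_part p G x) = p ^ k" using ord_p_part(2)[OF x] by blast
    have "p ^ k dvd p ^ j \<longleftrightarrow> k \<le> j" for j
      using prime prime_gt_1_nat power_dvd_imp_le le_imp_power_dvd by metis
    moreover have "p ^ k = p ^ Suc i \<longleftrightarrow> k = Suc i"
      using prime_gt_1_nat[OF prime] power_inject_exp by blast
    ultimately show ?thesis
      using ord_p_part(3)[OF x] unfolding k by (metis le_Suc_eq not_less_eq_eq order_refl)
  qed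
  then show ?thesis using ord_p_part(1) by blast
qed

lemma card_layer:
  "card {x \<in> carrier G. ord x dvd p ^ Suc i * m \<and> \<not> ord x dvd p ^ i * m}
    = (\<Sum>y\<in>{y \<in> carrier G. ord y = p ^ Suc i}. card (centralizer y \<inter> p_regular p))"
  unfolding layer_eq by (rule card_p_part_vimage[OF prime finite]) (auto intro!: exI[of _ "Suc i"])

text \<open>The coprime factors are treated separately. Orders in the layer are multiples of
  \<open>p ^ Suc i\<close>, so grouping by generated subgroup yields the factor \<open>p ^ i\<close>
  of \<open>totient (p ^ Suc i)\<close>. The factor \<open>m\<close> comes from the class sum over
  the elements of order \<open>p ^ Suc i\<close>, with \<open>dvd_card_p_regular\<close> applied in
  their centralizers.\<close>

lemma dvd_card_layer:
  "p ^ i * m dvd card {x \<in> carrier G. ord x dvd p ^ Suc i * m \<and> \<not> ord x dvd p ^ i * m}"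
proof -
  have "p ^ i dvd card {x \<in> carrier G. ord x \<in> {d. d dvd p ^ Suc i * m \<and> \<not> d dvd p ^ i * m}}"
  proof (rule dvd_card_ord_in[OF finite])
    fix x assume "ord x \<in> {d. d dvd p ^ Suc i * m \<and> \<not> d dvd p ^ i * m}"
    then have "totient (p ^ Suc i) dvd totient (ord x)"
      using prime_power_dvd_of_dvd_Suc[OF prime] totient_dvd by blast
    moreover have "p ^ i dvd totient (p ^ Suc i)"
      unfolding totient_prime_power_Suc[OF prime] by (rule dvd_triv_left)
    ultimately show "p ^ i dvd totient (ord x)" by (rule dvd_trans[rotated])
  qed
  then have "p ^ i dvd card {x \<in> carrier G. ord x dvd p ^ Suc i * m \<and> \<not> ord x dvd p ^ i * m}"
    by simp
  moreover have "m dvd card {x \<in> carrier G. ord x dvd p ^ Suc i * m \<and> \<not> ord x dvd p ^ i * m}"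
    unfolding card_layer
  proof (rule dvd_sum_conj_invariant[OF finite])
    fix y assume "y \<in> {y \<in> carrier G. ord y = p ^ Suc i}"
    then have y: "y \<in> carrier G" by simp
    have C: "subgroup (centralizer y) G" by (rule subgroup_centralizer[OF y])
    show "m dvd card (conj_class y) * card (centralizer y \<inter> p_regular p)"
    proof (rule dvd_card_conj_class_mult_regular[OF prime order coprime y])
      show "order G \<noteq> 0" using finite order_gt_0_iff_finite by auto
      fix a' b' assume *: "card (centralizer y) = p ^ a' * b'" "\<not> p dvd b'"
      have "finite (centralizer y)" using finite by (simp add: centralizer_def)
      then have "b' dvd card (group.p_regular (G\<lparr>carrier := centralizer y\<rparr>) p)"
        using * by (intro dvd_card_p_regular[OF prime subgroup_imp_group[OF C]])
          (auto simp: order_def)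
      then show "b' dvd card (centralizer y \<inter> p_regular p)"
        using p_regular_subgroup[OF is_group C] by simp
    qed
  qed (auto simp: ord_conj card_centralizer_regular_conj finite)
  moreover have "Rings.coprime (p ^ i) m"
    using prime coprime by (simp add: prime_imp_coprime)
  ultimately show ?thesis by (simp add: divides_mult)
qed

text \<open>Descending induction from \<open>num n\<close>, the order of \<open>G\<close>: passing
  from \<open>Suc i\<close> to \<open>i\<close> removes a layer whose size is divisible by
  \<open>p ^ i * m\<close>.\<close>

theorem dvd_num:
  assumes "i \<le> n"
  shows "p ^ i * m dvd num i"
  using assms
proof (induction rule: inc_induct)
  case base
  then show ?case by (simp add: num_top)
next
  case (step i)
  have "p ^ i * m dvd p ^ Suc i * m" by (simp add: mult_dvd_mono)
  then have "p ^ i * m dvd num (Suc i)" using step.IH dvd_trans by blast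
  then show ?case
    by (simp only: num_Suc dvd_add_left_iff[OF dvd_card_layer])
qed

lemma num_ge:
  assumes "i \<le> n"
  shows "p ^ i * m \<le> num i"
proof (rule dvd_imp_le[OF dvd_num[OF assms]])
  have "\<one> \<in> {x \<in> carrier G. ord x dvd p ^ i * m}" by simp
  then show "0 < num i" unfolding num_def using finite by (subst card_gt_0_iff) auto
qed

text \<open>The terms with \<open>k \<le> i\<close> telescope to \<open>p ^ n - p ^ k\<close>. The
  indicator keeps the index range independent of \<open>k\<close>, so that the sum can later be
  interchanged with a sum over the group.\<close>

lemma prime_power_telescope:
  assumes "k \<le> n"
  shows "p ^ k + (\<Sum>i<n. (p ^ Suc i - p ^ i) * of_bool (k \<le> i)) = p ^ n"
  using assms
proof (induction n rule: dec_induct)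
  case base
  have "(\<Sum>i<k. (p ^ Suc i - p ^ i) * of_bool (k \<le> i)) = 0" by (rule sum.neutral) simp
  then show ?case by simp
next
  case (step j)
  have "p ^ j \<le> p ^ Suc j" using prime_gt_0_nat[OF prime] by simp
  moreover have "(\<Sum>i<Suc j. (p ^ Suc i - p ^ i) * of_bool (k \<le> i))
    = (\<Sum>i<j. (p ^ Suc i - p ^ i) * of_bool (k \<le> i)) + (p ^ Suc j - p ^ j)"
    unfolding sum.lessThan_Suc using step.hyps(1) by simp
  ultimately show ?case using step.IH by linarith
qed

text \<open>Sum the telescoping identity over all elements and interchange the sums. Writing the
  correction on the left avoids subtracting it in the natural numbers.\<close>

lemma psi_add: "psi p G + (\<Sum>i<n. (p ^ Suc i - p ^ i) * num i) = p ^ n * (p ^ n * m)"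
proof -
  have *: "ord (p_part p G x) + (\<Sum>i<n. (p ^ Suc i - p ^ i) * of_bool (ord x dvd p ^ i * m)) = p ^ n"
    if x: "x \<in> carrier G" for x
  proof -
    obtain k where k: "ord (p_part p G x) = p ^ k" "k \<le> n" using ord_p_part(2)[OF x] by blast
    have "p ^ k dvd p ^ i \<longleftrightarrow> k \<le> i" for i
      using prime prime_gt_1_nat power_dvd_imp_le le_imp_power_dvd by metis
    then have "ord x dvd p ^ i * m \<longleftrightarrow> k \<le> i" for i
      using ord_p_part(3)[OF x] unfolding k by simp
    then show ?thesis using prime_power_telescope[OF k(2)] k(1) by simp
  qed
  have "(\<Sum>i<n. (p ^ Suc i - p ^ i) * num i)
    = (\<Sum>i<n. \<Sum>x\<in>carrier G. (p ^ Suc i - p ^ i) * of_bool (ord x dvd p ^ i * m))"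
    unfolding num_def using finite
    by (simp flip: sum_distrib_left add: Int_def)
  also have "\<dots> = (\<Sum>x\<in>carrier G. \<Sum>i<n. (p ^ Suc i - p ^ i) * of_bool (ord x dvd p ^ i * m))"
    by (rule sum.swap)
  finally have "psi p G + (\<Sum>i<n. (p ^ Suc i - p ^ i) * num i)
    = (\<Sum>x\<in>carrier G. ord (p_part p G x)
        + (\<Sum>i<n. (p ^ Suc i - p ^ i) * of_bool (ord x dvd p ^ i * m)))"
    by (simp only: psi_def sum.distrib)
  also have "\<dots> = (\<Sum>x\<in>carrier G. p ^ n)" using * by (intro sum.cong) auto
  also have "\<dots> = p ^ n * (p ^ n * m)" using order by (simp add: order_def)
  finally show ?thesis .
qed

end

section \<open>Comparison with the cyclic group of the same order\<close>

lemma card_integer_mod_group_pow: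
  assumes "N = a * d" "N > 0"
  shows "card {x \<in> carrier (integer_mod_group N). group.ord (integer_mod_group N) x dvd d} = d"
proof -
  have pos: "a > 0" "d > 0" using assms by auto
  \<comment> \<open>Modulo \<open>N = a * d\<close>, the equation \<open>d * x = 0\<close> says that
    \<open>a * d\<close> divides \<open>d * x\<close>.\<close>
  have "group.ord (integer_mod_group N) x dvd d \<longleftrightarrow> int a dvd x"
    if "x \<in> carrier (integer_mod_group N)" for x
  proof -
    have "group.ord (integer_mod_group N) x dvd d \<longleftrightarrow> int a * int d dvd int d * x"
      using group.pow_eq_id[OF group_integer_mod_group that, of d] assms
      by (simp add: mod_eq_0_iff_dvd)
    then show ?thesis using pos by (simp add: mult.commute)
  qed
  then have "{x \<in> carrier (integer_mod_group N). group.ord (integer_mod_group N) x dvd d}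
    = {x \<in> {0..<int a * int d}. int a dvd x}"
    using assms by (auto simp: carrier_integer_mod_group)
  also have "\<dots> = (\<lambda>k. int a * k) ` {0..<int d}"
    using pos by (auto elim!: dvdE simp: zero_le_mult_iff)
  finally show ?thesis using pos by (simp add: card_image inj_on_def)
qed

context p_m_group
begin

lemma m_pos: "m > 0"
  using order finite order_gt_0_iff_finite by (metis mult_0_right neq0_conv less_irrefl)

text \<open>The cyclic group is itself an instance of \<open>p_m_group\<close>, and its counts
  attain the lower bound \<open>p ^ i * m\<close>, whose cofactor in \<open>p ^ n * m\<close> is
  \<open>p ^ (n - i)\<close>.\<close>

lemma psi_integer_mod_group:
  "psi p (integer_mod_group (p ^ n * m)) + (\<Sum>i<n. (p ^ Suc i - p ^ i) * (p ^ i * m))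
    = p ^ n * (p ^ n * m)"
proof -
  have N: "p ^ n * m > 0" using m_pos prime_gt_0_nat[OF prime] by simp
  interpret C: p_m_group "integer_mod_group (p ^ n * m)" p n m
    using N prime coprime
    by (intro p_m_group.intro p_m_group_axioms.intro)
      (auto simp: order_def carrier_integer_mod_group nat_mult_distrib nat_power_eq)
  have "C.num i = p ^ i * m" if "i < n" for i
    unfolding C.num_def using N that
    by (intro card_integer_mod_group_pow[of _ "p ^ (n - i)"]) (simp_all flip: power_add mult.assoc)
  then show ?thesis using C.psi_add by simp
qed

text \<open>\<open>psi\<close> and its correction term have the same total in both groups, and by
  \<open>num_ge\<close> the correction is smallest in the cyclic group.\<close>

theorem psi_le: "psi p G \<le> psi p (integer_mod_group (p ^ n * m))"
proof -
  have "(\<Sum>i<n. (p ^ Suc i - p ^ i) * (p ^ i * m)) \<le> (\<Sum>i<n. (p ^ Suc i - p ^ i) * num i)"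
    using num_ge by (intro sum_mono mult_le_mono2) simp
  then show ?thesis using psi_add psi_integer_mod_group by linarith
qed

text \<open>The correction sums are compared term by term, so their equality forces equality in each
  term; the weights \<open>p ^ Suc i - p ^ i\<close> are positive and cancel.\<close>

theorem psi_eq_iff:
  "psi p G = psi p (integer_mod_group (p ^ n * m)) \<longleftrightarrow> (\<forall>i<n. num i = p ^ i * m)"
proof -
  have "psi p G = psi p (integer_mod_group (p ^ n * m)) \<longleftrightarrow>
    (\<Sum>i<n. (p ^ Suc i - p ^ i) * (p ^ i * m)) = (\<Sum>i<n. (p ^ Suc i - p ^ i) * num i)"
    using psi_add psi_integer_mod_group by linarith
  also have "\<dots> \<longleftrightarrow> (\<forall>i<n. num i = p ^ i * m)"
  proof
    assume eq: "(\<Sum>i<n. (p ^ Suc i - p ^ i) * (p ^ i * m)) = (\<Sum>i<n. (p ^ Suc i - p ^ i) * num i)"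
    have "(p ^ Suc i - p ^ i) * (p ^ i * m) = (p ^ Suc i - p ^ i) * num i" if "i < n" for i
      using that num_ge by (intro sum_mono_inv[OF eq]) auto
    moreover have "p ^ Suc i - p ^ i > 0" for i
      using prime_gt_1_nat[OF prime] by simp
    ultimately show "\<forall>i<n. num i = p ^ i * m" by (metis mult_left_cancel less_irrefl)
  qed simp
  finally show ?thesis .
qed

end

section \<open>Fusion in a cyclic Sylow subgroup\<close>

context group
begin

lemma rcosets_r_coset_closed:
  assumes "subgroup P G" "X \<in> rcosets P" "g \<in> carrier G"
  shows "X #> g \<in> rcosets P"
proof -
  obtain x where "x \<in> carrier G" "X = P #> x" using assms(2) by (auto simp: RCOSETS_def)
  then show ?thesis
    using assms subgroup.subset[OF assms(1)]
    by (auto simp: coset_mult_assoc intro: rcosetsI)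
qed

lemma rcosets_subset_carrier: "subgroup P G \<Longrightarrow> X \<in> rcosets P \<Longrightarrow> X \<subseteq> carrier G"
  using rcosets_subset_PowG by blast

lemma funpow_r_coset:
  assumes "X \<subseteq> carrier G" "g \<in> carrier G"
  shows "((\<lambda>X. X #> g) ^^ i) X = X #> g [^] i"
proof (induction i)
  case (Suc i)
  then show ?case using assms by (simp add: coset_mult_assoc)
qed (use assms in simp)

lemma finite_rcosets: "finite (carrier G) \<Longrightarrow> subgroup P G \<Longrightarrow> finite (rcosets P)"
  using rcosets_subset_PowG finite_subset by blast

lemma r_coset_fixed_iff:
  assumes "subgroup P G" "x \<in> carrier G" "g \<in> carrier G"
  shows "P #> x #> g = P #> x \<longleftrightarrow> x \<otimes> g \<otimes> inv x \<in> P"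
proof -
  have "P #> x #> g = P #> x \<longleftrightarrow> P #> (x \<otimes> g) = P #> x"
    using assms subgroup.subset[OF assms(1)] by (simp add: coset_mult_assoc)
  also have "\<dots> \<longleftrightarrow> x \<otimes> g \<in> P #> x"
    using assms rcos_self repr_independence by (metis m_closed)
  also have "\<dots> \<longleftrightarrow> x \<otimes> g \<otimes> inv x \<in> P"
    using subgroup.rcos_module[OF assms(1) is_group] assms by simp
  finally show ?thesis .
qed

text \<open>The fixed point proof of Sylow's conjugacy theorem. Right multiplication by
  \<open>q\<close> permutes the cosets with \<open>p\<close>-power period, so the number of fixed
  cosets is congruent to the index modulo \<open>p\<close> and hence nonzero. A fixed coset
  \<open>P #> x\<close> means that \<open>x\<close> conjugates \<open>q\<close> into
  \<open>P\<close>.\<close>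

lemma conj_into_subgroup:
  assumes "finite (carrier G)" "Factorial_Ring.prime p" "subgroup P G" "\<not> p dvd card (rcosets P)"
    and "q \<in> carrier G" "ord q = p ^ k"
  shows "\<exists>g\<in>carrier G. g \<otimes> q \<otimes> inv g \<in> P"
proof -
  have "[card (rcosets P) = card {X \<in> rcosets P. X #> q = X}] (mod p)"
  proof (rule card_fixed_cong_prime_power_period[OF assms(2) finite_rcosets[OF assms(1,3)]])
    show "(\<lambda>X. X #> q) \<in> rcosets P \<rightarrow> rcosets P"
      using rcosets_r_coset_closed assms by auto
    have "q [^] (p ^ k) = \<one>" using pow_ord_eq_1[OF assms(5)] assms(6) by simp
    then show "((\<lambda>X. X #> q) ^^ (p ^ k)) X = X" if "X \<in> rcosets P" for X
      using funpow_r_coset rcosets_subset_carrier[OF assms(3) that] assms(5) by simp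
  qed
  then have "card {X \<in> rcosets P. X #> q = X} \<noteq> 0"
    using assms(4) by (metis cong_0_iff)
  then obtain X where X: "X \<in> rcosets P" "X #> q = X"
    by (metis (mono_tags, lifting) card.empty empty_Collect_eq)
  then obtain x where "x \<in> carrier G" "X = P #> x" by (auto simp: RCOSETS_def)
  then show ?thesis using X r_coset_fixed_iff[OF assms(3) _ assms(5)] by blast
qed

lemma powers_subset_subgroup:
  assumes "subgroup C G" "y \<in> C"
  shows "powers y \<subseteq> C"
proof -
  interpret C: group "G\<lparr>carrier := C\<rparr>" using assms(1) by (rule subgroup_imp_group)
  show ?thesis
    using assms(2) C.nat_pow_closed[of y] by (auto simp: powers_def simp flip: nat_pow_consistent)
qed

text \<open>If \<open>g\<close> commutes with \<open>x\<close>, then the centralizer of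
  \<open>g\<close> is a subgroup containing \<open>x\<close>, hence also its powers.\<close>

lemma centralizer_powers_mono:
  assumes "x \<in> carrier G" "y \<in> powers x"
  shows "centralizer x \<subseteq> centralizer y"
proof
  fix g assume g: "g \<in> centralizer x"
  then have gG: "g \<in> carrier G" by (simp add: centralizer_def)
  have "x \<in> centralizer g" using g assms(1) by (simp add: centralizer_def)
  then have "y \<in> centralizer g"
    using powers_subset_subgroup[OF subgroup_centralizer[OF gG]] assms(2) by blast
  then show "g \<in> centralizer y" using gG by (simp add: centralizer_def)
qed

text \<open>Multiply a power \<open>v\<close> of \<open>w\<close> by a \<open>p\<close>-regular
  \<open>z\<close> centralizing \<open>w\<close>. The product lies in the centralizer, and
  \<open>v\<close> is recovered as its \<open>p\<close>-part, so this map on pairs is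
  injective.\<close>

lemma card_centralizer_regular_le:
  assumes "finite (carrier G)" "Factorial_Ring.prime p" "w \<in> carrier G" "ord w = p ^ k"
  shows "p ^ k * card (centralizer w \<inter> p_regular p) \<le> card (centralizer w)"
proof -
  define R where "R = centralizer w \<inter> p_regular p"
  have "p ^ k * card R = card (powers w \<times> R)"
    using card_powers[OF assms(1,3)] assms(4) by (simp add: card_cartesian_product)
  also have "\<dots> \<le> card (centralizer w)"
  proof (rule card_inj_on_le)
    have *: "v \<in> carrier G" "z \<in> carrier G" "p_part p G (v \<otimes> z) = v" "v \<otimes> z \<in> centralizer w"
      if vz: "v \<in> powers w" "z \<in> R" for v z
    proof -
      show v: "v \<in> carrier G" using powers_subset[OF assms(3)] vz by blast
      show z: "z \<in> carrier G" using vz by (simp add: R_def p_regular_def)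
      obtain j :: nat where "v = w [^] j" using vz by (auto simp: powers_def)
      then have "v [^] (p ^ k) = w [^] (p ^ k * j)"
        using assms(3) by (simp add: nat_pow_pow mult.commute)
      also have "\<dots> = \<one>"
        using pow_eq_id[OF assms(3), of "p ^ k * j"] assms(4) by simp
      finally have "ord v dvd p ^ k" using pow_eq_id[OF v] by simp
      then obtain i where "ord v = p ^ i" using divides_primepow_nat[OF assms(2)] by blast
      moreover have "z \<in> centralizer v \<inter> p_regular p"
        using centralizer_powers_mono[OF assms(3) vz(1)] vz(2) by (auto simp: R_def)
      ultimately show "p_part p G (v \<otimes> z) = v"
        using p_part_eq_iff[OF assms(2,1)] is_p_part_mult v z by simp
      have "w \<in> centralizer w" using assms(3) by (simp add: centralizer_def)
      then have "v \<in> centralizer w"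
        using powers_subset_subgroup[OF subgroup_centralizer[OF assms(3)]] vz(1) by blast
      then show "v \<otimes> z \<in> centralizer w"
        using vz(2) subgroup.m_closed[OF subgroup_centralizer[OF assms(3)]] by (simp add: R_def)
    qed
    show "inj_on (\<lambda>(v, z). v \<otimes> z) (powers w \<times> R)"
    proof (rule inj_onI, clarify)
      fix v z v' z' assume h: "v \<in> powers w" "z \<in> R" "v' \<in> powers w" "z' \<in> R" "v \<otimes> z = v' \<otimes> z'"
      then have "v = v'" using *(3) by metis
      moreover have "v \<in> carrier G" "z \<in> carrier G" "z' \<in> carrier G" using * h by blast+
      ultimately show "v = v' \<and> z = z'" using h(5) by simp
    qed
    show "(\<lambda>(v, z). v \<otimes> z) ` (powers w \<times> R) \<subseteq> centralizer w" using *(4) by auto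
    show "finite (centralizer w)" using assms(1) by (simp add: centralizer_def)
  qed
  finally show ?thesis by (simp add: R_def)
qed

end

context p_m_group
begin

lemma order_pos: "order G > 0"
  using finite order_gt_0_iff_finite by blast

text \<open>The index times \<open>p ^ n\<close> is \<open>card C\<close>, which divides
  \<open>p ^ n * m\<close>, so the index divides \<open>m\<close>. An intermediate subgroup
  \<open>C\<close> is allowed because Sylow's argument is used both in \<open>G\<close> and in a
  centralizer.\<close>

lemma coprime_index:
  assumes "subgroup C G" "y \<in> C" "ord y = p ^ n"
  shows "\<not> p dvd card (rcosets\<^bsub>G\<lparr>carrier := C\<rparr>\<^esub> (powers y))"
proof -
  interpret C: group "G\<lparr>carrier := C\<rparr>" using assms(1) by (rule subgroup_imp_group)
  have y: "y \<in> carrier G" using subgroup.mem_carrier[OF assms(1,2)] .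
  have "subgroup (powers y) (G\<lparr>carrier := C\<rparr>)"
    using subgroup_powers[OF finite y] assms powers_subset_subgroup subgroup_incl by blast
  then have "card (rcosets\<^bsub>G\<lparr>carrier := C\<rparr>\<^esub> (powers y)) * p ^ n = card C"
    using C.lagrange[of "powers y"] card_powers[OF finite y] assms(3) by (simp add: order_def)
  also have "card C dvd p ^ n * m"
    using lagrange[OF assms(1)] order by (metis dvd_triv_right)
  finally have "card (rcosets\<^bsub>G\<lparr>carrier := C\<rparr>\<^esub> (powers y)) dvd m"
    using prime_gt_0_nat[OF prime] by (simp add: mult.commute)
  then show ?thesis using coprime dvd_trans by blast
qed

text \<open>Without such an element the top layer would be empty, so \<open>num n\<close> and
  \<open>num l\<close> would coincide.\<close>

lemma exists_ord_top:
  assumes "n = Suc l" "num l = p ^ l * m"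
  shows "\<exists>y\<in>carrier G. ord y = p ^ n"
proof (rule ccontr)
  assume "\<not> (\<exists>y\<in>carrier G. ord y = p ^ n)"
  then have "{y \<in> carrier G. ord y = p ^ Suc l} = {}" using assms(1) by blast
  then have "num (Suc l) = num l" unfolding num_Suc card_layer by (simp only: sum.empty add_0_right)
  then have "p ^ Suc l * m = p ^ l * m" using num_top assms by metis
  then show False using prime_gt_1_nat[OF prime] m_pos by simp
qed

text \<open>Counting the elements whose \<open>p\<close>-part has maximal order: a conjugacy between two distinct
  generators of the Sylow subgroup would make the classes of its generators too few to account
  for all of them.\<close>

lemma generator_conj_eq:
  assumes "n = Suc l" "num l = p ^ l * m" "y \<in> carrier G" "ord y = p ^ n"
    and "y' \<in> powers y" "y' \<in> conj_class y"
  shows "y' = y"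
proof (rule ccontr)
  assume "y' \<noteq> y"
  define W where "W = {w \<in> carrier G. ord w = p ^ n}"
  define U where "U = {u \<in> carrier G. powers u = powers y}"
  define c where "c = card (conj_class y)"
  have finU: "finite U" using finite by (simp add: U_def)
  have cardU: "card U = totient (p ^ n)"
    using card_generators[OF finite assms(3)] assms(4) by (simp add: U_def)
  have y'G: "y' \<in> carrier G" using assms(3,5) powers_subset by blast
  have UI: "u \<in> U" if "u \<in> powers y" "u \<in> W" for u
    using that powers_eq_iff[OF finite assms(3)] assms(4) by (simp add: U_def W_def)
  have "y' \<in> W" using assms(3,4,6) y'G by (auto simp: conj_class_def ord_conj W_def)
  then have y'U: "y' \<in> U" using UI assms(5) by blast
  have yU: "y \<in> U" using assms(3) by (simp add: U_def)
  \<comment> \<open>Generators of one cyclic group are powers of each other, so their centralizers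
    agree and their classes have the same size \<open>c\<close>.\<close>
  have centr: "centralizer u = centralizer y" if "u \<in> U" for u
    using that centralizer_powers_mono[of u y] centralizer_powers_mono[of y u] assms(3)
      self_in_powers[of u] self_in_powers[of y] by (auto simp: U_def)
  have conj_mem: "g \<otimes> w \<otimes> inv g \<in> carrier G \<and> w \<in> conj_class (g \<otimes> w \<otimes> inv g)"
    if "g \<in> carrier G" "w \<in> carrier G" for g w
    using that conj_inv[of g w] unfolding conj_class_def
    by (auto intro!: image_eqI[of _ _ "inv g"])
  \<comment> \<open>The index of \<open>powers y\<close> is prime to \<open>p\<close>, so every
    element of order \<open>p ^ n\<close> is conjugate into \<open>powers y\<close>, where it is a
    generator.\<close>
  have sylow: "\<exists>u\<in>U. w \<in> conj_class u" if "w \<in> W" for w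
  proof -
    have "\<not> p dvd card (rcosets (powers y))"
      using coprime_index[OF subgroup_self assms(3,4)] by simp
    moreover have w: "w \<in> carrier G" "ord w = p ^ n" using that by (auto simp: W_def)
    ultimately obtain g where g: "g \<in> carrier G" "g \<otimes> w \<otimes> inv g \<in> powers y"
      using conj_into_subgroup[OF finite prime subgroup_powers[OF finite assms(3)]] by blast
    then have "g \<otimes> w \<otimes> inv g \<in> U" using w UI by (simp add: W_def ord_conj)
    then show ?thesis using conj_mem g(1) w(1) by blast
  qed
  have card_conj: "card (conj_class u) = c" if "u \<in> U" for u
  proof -
    have "card (conj_class u) * card (centralizer y) = c * card (centralizer y)"
      using card_conj_class_mult_card_centralizer[of u] card_conj_class_mult_card_centralizer[of y]
        assms(3) that centr[OF that] by (simp add: U_def c_def)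
    moreover have "card (centralizer y) \<noteq> 0"
      using card_conj_class_mult_card_centralizer[OF assms(3)] order_pos by (metis mult_0_right less_irrefl)
    ultimately show ?thesis by simp
  qed
  have "conj_class y' = conj_class y"
    using conj_class_eq_iff[OF y'G assms(3)] assms(6) by simp
  have "W \<subseteq> (\<Union>u\<in>U - {y'}. conj_class u)"
  proof
    fix w assume "w \<in> W"
    then obtain u where u: "u \<in> U" "w \<in> conj_class u" using sylow by blast
    then have "w \<in> conj_class (if u = y' then y else u)"
      using \<open>conj_class y' = conj_class y\<close> by (cases "u = y'") auto
    moreover have "(if u = y' then y else u) \<in> U - {y'}" using u(1) yU \<open>y' \<noteq> y\<close> by simp
    ultimately show "w \<in> (\<Union>u\<in>U - {y'}. conj_class u)" by blast
  qed
  then have "card W \<le> card (\<Union>u\<in>U - {y'}. conj_class u)"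
    using finU finite by (intro card_mono) (auto simp: conj_class_def)
  also have "\<dots> \<le> (\<Sum>u\<in>U - {y'}. card (conj_class u))"
    using finU by (intro card_UN_le) simp
  also have "\<dots> = (totient (p ^ n) - 1) * c"
    using card_conj cardU y'U finU by simp
  finally have W: "card W \<le> (totient (p ^ n) - 1) * c" .
  \<comment> \<open>Upper bound for the top layer: each fibre has at most
    \<open>card (centralizer y) / p ^ n\<close> elements, and
    \<open>c * card (centralizer y)\<close> is the order of \<open>G\<close>.\<close>
  have "p ^ n * (\<Sum>w\<in>W. card (centralizer w \<inter> p_regular p))
    = (\<Sum>w\<in>W. p ^ n * card (centralizer w \<inter> p_regular p))"
    by (rule sum_distrib_left)
  also have "\<dots> \<le> (\<Sum>w\<in>W. card (centralizer y))"
  proof (rule sum_mono)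
    fix w assume w: "w \<in> W"
    then obtain u where u: "u \<in> U" "w \<in> conj_class u" using sylow by blast
    then obtain g where "g \<in> carrier G" "w = g \<otimes> u \<otimes> inv g" by (auto simp: conj_class_def)
    then have "card (centralizer w) = card (centralizer y)"
      using card_centralizer_conj[OF finite] u centr by (simp add: U_def)
    then show "p ^ n * card (centralizer w \<inter> p_regular p) \<le> card (centralizer y)"
      using card_centralizer_regular_le[OF finite prime, of w n] w by (simp add: W_def)
  qed
  also have "\<dots> = card W * card (centralizer y)" by simp
  also have "\<dots> \<le> (totient (p ^ n) - 1) * c * card (centralizer y)"
    using W by (rule mult_right_mono) simp
  also have "\<dots> = (totient (p ^ n) - 1) * (p ^ n * m)"
    using card_conj_class_mult_card_centralizer[OF assms(3)] order by (simp add: c_def mult.assoc)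
  finally have le: "p ^ n * (\<Sum>w\<in>W. card (centralizer w \<inter> p_regular p))
    \<le> (totient (p ^ n) - 1) * (p ^ n * m)" .
  have tot: "totient (p ^ n) = p ^ l * (p - 1)"
    using totient_prime_power_Suc[OF prime] assms(1) by simp
  \<comment> \<open>Exact size of the top layer: \<open>p ^ n * m - p ^ l * m\<close>, which is
    \<open>totient (p ^ n) * m\<close> and exceeds the bound.\<close>
  have "p ^ n * m = p ^ l * m + (\<Sum>w\<in>W. card (centralizer w \<inter> p_regular p))"
    using num_Suc[of l] card_layer[of l] num_top assms(1,2) unfolding W_def by metis
  moreover have "p ^ n = p ^ l * (1 + (p - 1))"
    using assms(1) prime_gt_0_nat[OF prime] by simp
  then have "p ^ n = p ^ l + totient (p ^ n)"
    unfolding tot by (metis distrib_left mult_1_right)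
  then have "p ^ n * m = p ^ l * m + totient (p ^ n) * m"
    by (metis distrib_right)
  ultimately have "(\<Sum>w\<in>W. card (centralizer w \<inter> p_regular p)) = totient (p ^ n) * m" by simp
  then have "totient (p ^ n) * (p ^ n * m) \<le> (totient (p ^ n) - 1) * (p ^ n * m)"
    using le by (simp add: ac_simps)
  moreover have "totient (p ^ n) > 0" "p ^ n * m > 0"
    using prime_gt_0_nat[OF prime] m_pos by auto
  ultimately show False by (metis diff_less mult_le_cancel2 not_less zero_less_one)
qed

text \<open>Both \<open>y\<close> and its conjugate \<open>y'\<close> by \<open>r\<close> centralize
  \<open>u\<close>, since \<open>u\<close> and its conjugate generate the same subgroup. Sylow's
  argument in the centralizer of \<open>u\<close> gives \<open>c\<close> there that conjugates
  \<open>y'\<close> into \<open>powers y\<close>, hence to \<open>y\<close> by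
  \<open>generator_conj_eq\<close>. Then \<open>c \<otimes> r\<close> centralizes \<open>y\<close>
  and so \<open>u\<close>; as \<open>c\<close> centralizes \<open>u\<close>, so does
  \<open>r\<close>.\<close>

lemma prime_order_conj_eq:
  assumes "n = Suc l" "num l = p ^ l * m" "y \<in> carrier G" "ord y = p ^ n"
    and "u \<in> powers y" "ord u = p" "r \<in> carrier G" "r \<otimes> u \<otimes> inv r \<in> powers y"
  shows "r \<otimes> u \<otimes> inv r = u"
proof -
  define v where "v = r \<otimes> u \<otimes> inv r"
  define y' where "y' = r \<otimes> y \<otimes> inv r"
  define t where "t = y [^] (p ^ l)"
  have uG: "u \<in> carrier G" using assms(3,5) powers_subset by blast
  have vG: "v \<in> carrier G" and y'G: "y' \<in> carrier G" and tG: "t \<in> carrier G"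
    using assms uG by (auto simp: v_def y'_def t_def)
  have ord_v: "ord v = p" using assms(6,7) uG by (simp add: v_def ord_conj)
  have ord_t: "ord t = p"
    using assms(1,3,4) prime_gt_0_nat[OF prime]
    by (simp add: t_def ord_pow_gen gcd_nat.absorb2)
  \<comment> \<open>\<open>t\<close> generates the only subgroup of order \<open>p\<close> in the
    cyclic group \<open>powers y\<close>.\<close>
  have in_t: "x \<in> powers t" if x: "x \<in> powers y" "ord x = p" for x
  proof -
    obtain k :: nat where k: "x = y [^] k" using x(1) by (auto simp: powers_def)
    then have "y [^] (k * p) = \<one>"
      using x(2) pow_ord_eq_1[of x] assms(3) by (simp add: nat_pow_pow)
    then have "p ^ n dvd k * p" using pow_eq_id[OF assms(3)] assms(4) by simp
    then have "p ^ l dvd k" using assms(1) prime_gt_0_nat[OF prime] by (simp add: mult.commute)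
    then obtain j where "k = p ^ l * j" by blast
    then have "x = t [^] j" using k assms(3) by (simp add: t_def nat_pow_pow)
    then show ?thesis by (simp add: powers_def)
  qed
  have "powers u = powers t" "powers v = powers t"
    using in_t assms(5,6,8) ord_v ord_t powers_eq_iff[OF finite tG] uG vG
    by (auto simp: v_def)
  then have u_v: "u \<in> powers v" using self_in_powers[OF uG] by simp
  have "v \<in> powers y'"
    using assms(3,5,7) by (auto simp: v_def y'_def powers_def conj_pow)
  then have "centralizer y' \<subseteq> centralizer u"
    using centralizer_powers_mono[OF y'G] centralizer_powers_mono[OF vG u_v] by blast
  then have y'C: "y' \<in> centralizer u" using y'G by (auto simp: centralizer_def)
  have y_C: "centralizer y \<subseteq> centralizer u" by (rule centralizer_powers_mono[OF assms(3,5)])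
  then have yC: "y \<in> centralizer u" using assms(3) by (auto simp: centralizer_def)
  have C: "subgroup (centralizer u) G" by (rule subgroup_centralizer[OF uG])
  interpret C: group "G\<lparr>carrier := centralizer u\<rparr>" using C by (rule subgroup_imp_group)
  have "subgroup (powers y) (G\<lparr>carrier := centralizer u\<rparr>)"
    using subgroup_powers[OF finite assms(3)] C yC powers_subset_subgroup subgroup_incl by blast
  moreover have "finite (carrier (G\<lparr>carrier := centralizer u\<rparr>))"
    using finite by (simp add: centralizer_def)
  moreover have "C.ord y' = p ^ n"
    using ord_subgroup[OF is_group C] assms(3,4,7) by (simp add: y'_def ord_conj)
  ultimately obtain c where c: "c \<in> centralizer u" "c \<otimes> y' \<otimes> inv\<^bsub>G\<lparr>carrier := centralizer u\<rparr>\<^esub> c \<in> powers y"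
    using C.conj_into_subgroup[OF _ prime _ coprime_index[OF C yC assms(4)], of y'] y'C by auto
  then have c': "c \<otimes> y' \<otimes> inv c \<in> powers y" using m_inv_consistent[OF C] by simp
  have cG: "c \<in> carrier G" using c(1) by (simp add: centralizer_def)
  have cr: "c \<otimes> y' \<otimes> inv c = (c \<otimes> r) \<otimes> y \<otimes> inv (c \<otimes> r)"
    using cG assms(3,7) by (simp only: y'_def conj_conj)
  then have "c \<otimes> y' \<otimes> inv c = y"
    using c' cG assms(7) by (intro generator_conj_eq[OF assms(1-4)]) (auto simp: conj_class_def)
  then have "c \<otimes> r \<in> centralizer u"
    using cr y_C assms(3,7) cG by (auto simp: centralizer_altdef)
  then have "c \<otimes> v \<otimes> inv c = u"
    using conj_conj[OF cG assms(7) uG] uG by (simp add: v_def centralizer_altdef)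
  moreover have "c \<otimes> u \<otimes> inv c = u" using c(1) uG by (simp add: centralizer_altdef)
  ultimately have "c \<otimes> v = c \<otimes> u" using cG uG vG by (metis conj_eq_iff)
  then show ?thesis using cG uG vG by (simp add: v_def)
qed

end

section \<open>Transfer and the normal complement\<close>

text \<open>The transfer \<open>G \<rightarrow> P\<close>, composed with a homomorphism \<open>l\<close> from \<open>P\<close> to the
  integers modulo \<open>M\<close>.\<close>

locale transfer = group +
  fixes P :: "'a set" and l :: "'a \<Rightarrow> int" and M :: int
  assumes finite: "finite (carrier G)" and P: "subgroup P G"
    and l_mult: "a \<in> P \<Longrightarrow> b \<in> P \<Longrightarrow> [l (a \<otimes> b) = l a + l b] (mod M)"
begin

definition rep :: "'a set \<Rightarrow> 'a" where
  "rep X = (SOME x. x \<in> X)"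

text \<open>The factor in \<open>P\<close> by which \<open>rep X \<otimes> g\<close> differs from
  the representative of its own coset \<open>X #> g\<close>.\<close>

definition cocycle :: "'a set \<Rightarrow> 'a \<Rightarrow> 'a" where
  "cocycle X g = rep X \<otimes> g \<otimes> inv (rep (X #> g))"

text \<open>The transfer as a product over cosets becomes a sum of integers under \<open>l\<close>,
  so no ordering of the cosets is chosen; its value matters only modulo \<open>M\<close>.\<close>

definition V :: "'a \<Rightarrow> int" where
  "V g = (\<Sum>X\<in>rcosets P. l (cocycle X g))"

lemma rep:
  assumes "X \<in> rcosets P"
  shows "rep X \<in> carrier G" "P #> rep X = X"
proof -
  obtain x where x: "x \<in> carrier G" "X = P #> x" using assms by (auto simp: RCOSETS_def)
  then have "rep X \<in> X" unfolding rep_def using rcos_self[OF x(1) P] by (metis someI)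
  then show "rep X \<in> carrier G" using rcosets_subset_carrier[OF P assms] by blast
  show "P #> rep X = X" using \<open>rep X \<in> X\<close> x repr_independence[OF _ x(1) P] by simp
qed

lemma l_one: "[l \<one> = 0] (mod M)"
  using l_mult[of \<one> \<one>] subgroup.one_closed[OF P] cong_add_lcancel_0[of "l \<one>" "l \<one>" M]
  by (simp add: cong_sym_eq)

lemma cocycle_mem:
  assumes "X \<in> rcosets P" "g \<in> carrier G"
  shows "cocycle X g \<in> P"
proof -
  have Xg: "X #> g \<in> rcosets P" by (rule rcosets_r_coset_closed[OF P assms])
  have "rep X \<otimes> g \<in> P #> (rep X \<otimes> g)"
    using rep(1)[OF assms(1)] assms(2) by (intro rcos_self[OF _ P]) simp
  also have "P #> (rep X \<otimes> g) = P #> rep X #> g"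
    using coset_mult_assoc[OF subgroup.subset[OF P] rep(1)[OF assms(1)] assms(2)] by simp
  also have "\<dots> = P #> rep (X #> g)"
    using rep(2)[OF assms(1)] rep(2)[OF Xg] by simp
  finally show ?thesis
    using subgroup.rcos_module[OF P is_group, of "rep (X #> g)" "rep X \<otimes> g"]
      rep(1)[OF Xg] rep(1)[OF assms(1)] assms(2) by (simp add: cocycle_def)
qed

lemma cocycle_mult:
  assumes "X \<in> rcosets P" "g \<in> carrier G" "h \<in> carrier G"
  shows "cocycle X (g \<otimes> h) = cocycle X g \<otimes> cocycle (X #> g) h"
proof -
  have Xg: "X #> g \<in> rcosets P" by (rule rcosets_r_coset_closed[OF P assms(1,2)])
  have Xgh: "X #> g #> h \<in> rcosets P" by (rule rcosets_r_coset_closed[OF P Xg assms(3)])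
  have "inv (rep (X #> g)) \<otimes> (rep (X #> g) \<otimes> (h \<otimes> inv (rep (X #> g #> h)))) = h \<otimes> inv (rep (X #> g #> h))"
    using rep(1)[OF Xg] rep(1)[OF Xgh] assms by (simp flip: m_assoc)
  then show ?thesis
    using rep(1)[OF Xg] rep(1)[OF Xgh] rep(1)[OF assms(1)] assms
      coset_mult_assoc[OF rcosets_subset_carrier[OF P assms(1)] assms(2,3)]
    by (simp add: cocycle_def m_assoc)
qed

text \<open>Sum the cocycle identity over all cosets; the shift by \<open>g\<close> in its second
  term only permutes them.\<close>

lemma V_mult:
  assumes "g \<in> carrier G" "h \<in> carrier G"
  shows "[V (g \<otimes> h) = V g + V h] (mod M)"
proof -
  have "bij_betw (\<lambda>X. X #> g) (rcosets P) (rcosets P)"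
  proof (rule bij_betw_byWitness[where f' = "\<lambda>X. X #> inv g"])
    show "(\<lambda>X. X #> g) ` (rcosets P) \<subseteq> rcosets P" "(\<lambda>X. X #> inv g) ` (rcosets P) \<subseteq> rcosets P"
      using rcosets_r_coset_closed[OF P] assms(1) by auto
  qed (use assms(1) rcosets_subset_carrier[OF P] in \<open>auto simp: coset_mult_assoc\<close>)
  then have "(\<Sum>X\<in>rcosets P. l (cocycle (X #> g) h)) = V h"
    unfolding V_def by (rule sum.reindex_bij_betw)
  then have "V g + V h = (\<Sum>X\<in>rcosets P. l (cocycle X g) + l (cocycle (X #> g) h))"
    by (simp add: V_def sum.distrib)
  moreover have "[V (g \<otimes> h) = (\<Sum>X\<in>rcosets P. l (cocycle X g) + l (cocycle (X #> g) h))] (mod M)"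
    unfolding V_def
  proof (rule cong_sum)
    fix X assume X: "X \<in> rcosets P"
    show "[l (cocycle X (g \<otimes> h)) = l (cocycle X g) + l (cocycle (X #> g) h)] (mod M)"
      unfolding cocycle_mult[OF X assms]
      by (intro l_mult cocycle_mem X rcosets_r_coset_closed[OF P] assms)
  qed
  ultimately show ?thesis by simp
qed

lemma V_one: "[V \<one> = 0] (mod M)"
  using V_mult[of \<one> \<one>] cong_add_lcancel_0[of "V \<one>" "V \<one>" M] by (simp add: cong_sym_eq)

lemma V_pow:
  assumes "g \<in> carrier G"
  shows "[V (g [^] (k::nat)) = int k * V g] (mod M)"
proof (induction k)
  case 0
  then show ?case using V_one by simp
next
  case (Suc k)
  have "[V (g [^] Suc k) = V (g [^] k) + V g] (mod M)"
    using V_mult[of "g [^] k" g] assms by simp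
  also have "[V (g [^] k) + V g = int k * V g + V g] (mod M)"
    using Suc by (intro cong_add) auto
  finally show ?case by (simp add: algebra_simps)
qed

text \<open>The cocycle identity telescopes along the successive translates of
  \<open>X\<close>.\<close>

lemma orbit_sum:
  fixes k :: nat
  assumes "X \<in> rcosets P" "g \<in> carrier G"
  shows "[(\<Sum>i<k. l (cocycle (X #> g [^] i) g)) = l (cocycle X (g [^] k))] (mod M)"
proof (induction k)
  case 0
  have "cocycle X \<one> = \<one>"
    using assms(1) rep(1)[OF assms(1)] rcosets_subset_carrier[OF P assms(1)] by (simp add: cocycle_def)
  then show ?case using l_one by (simp add: cong_sym_eq)
next
  case (Suc k)
  have "X #> g [^] k \<in> rcosets P" using assms by (intro rcosets_r_coset_closed[OF P]) simp_all
  then have "[l (cocycle X (g [^] Suc k)) = l (cocycle X (g [^] k)) + l (cocycle (X #> g [^] k) g)] (mod M)"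
    using assms cocycle_mult[OF assms(1), of "g [^] k" g] by (simp add: l_mult cocycle_mem)
  then show ?case using Suc by (simp add: cong_def) (metis mod_add_left_eq)
qed

text \<open>Cosets moved by \<open>u\<close> lie in orbits of length \<open>p\<close>, and such an
  orbit contributes \<open>l (cocycle X (u [^] p))\<close>, which vanishes modulo \<open>M\<close>.
  On a fixed coset the cocycle is a conjugate of \<open>u\<close>.\<close>

lemma V_prime_order:
  assumes "Factorial_Ring.prime p" "u \<in> carrier G" "u [^] (p::nat) = \<one>"
  shows "[V u = (\<Sum>X\<in>{X \<in> rcosets P. X #> u = X}. l (rep X \<otimes> u \<otimes> inv (rep X)))] (mod M)"
proof -
  let ?F = "{X \<in> rcosets P. X #> u = X}" and ?N = "{X \<in> rcosets P. X #> u \<noteq> X}"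
  have pow: "((\<lambda>X. X #> u) ^^ i) X = X #> u [^] i" if "X \<in> rcosets P" for i X
    using funpow_r_coset rcosets_subset_carrier[OF P that] assms(2) by blast
  have "M dvd (\<Sum>X\<in>?N. l (cocycle X u))"
  proof (rule dvd_sum_nonfixed[OF assms(1) finite_rcosets[OF finite P]])
    show "(\<lambda>X. X #> u) \<in> rcosets P \<rightarrow> rcosets P"
      using rcosets_r_coset_closed[OF P] assms(2) by blast
    show "((\<lambda>X. X #> u) ^^ p) X = X" if "X \<in> rcosets P" for X
      using pow[OF that] assms(3) rcosets_subset_carrier[OF P that] by simp
    show "M dvd (\<Sum>i<p. l (cocycle (((\<lambda>X. X #> u) ^^ i) X) u))" if X: "X \<in> rcosets P" for X
    proof -
      have "cocycle X \<one> = \<one>"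
        using rep(1)[OF X] rcosets_subset_carrier[OF P X] by (simp add: cocycle_def)
      then have "[(\<Sum>i<p. l (cocycle (X #> u [^] i) u)) = 0] (mod M)"
        using orbit_sum[OF X assms(2), of p] assms(3) l_one cong_trans by simp
      then show ?thesis by (simp add: pow[OF X] cong_0_iff)
    qed
  qed
  moreover have "V u = (\<Sum>X\<in>?F. l (cocycle X u)) + (\<Sum>X\<in>?N. l (cocycle X u))"
    unfolding V_def using finite_rcosets[OF finite P]
    by (subst sum.union_disjoint[symmetric]) (auto intro: sum.cong)
  moreover have "(\<Sum>X\<in>?F. l (cocycle X u)) = (\<Sum>X\<in>?F. l (rep X \<otimes> u \<otimes> inv (rep X)))"
    by (intro sum.cong) (auto simp: cocycle_def)
  ultimately show ?thesis by (simp add: cong_iff_dvd_diff)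
qed

end

lemma card_carrier_integer_mod_group: "N > 0 \<Longrightarrow> card (carrier (integer_mod_group N)) = N"
  by (simp add: carrier_integer_mod_group)

lemma (in group) powers_iso_integer_mod_group:
  assumes "finite (carrier G)" "y \<in> carrier G"
  shows "G\<lparr>carrier := powers y\<rparr> \<cong> integer_mod_group (ord y)"
proof -
  let ?Z = "integer_mod_group (ord y)" and ?f = "\<lambda>k::int. y [^] k"
  have pos: "ord y > 0" using ord_ge_1[OF assms] by simp
  have f: "?f k \<in> powers y" for k
    using generate_pow[OF assms(2)] generate_eq_powers[OF assms] by blast
  have mod: "?f (k mod int (ord y)) = ?f k" for k
    using int_pow_eq[OF assms(2)] by (simp add: dvd_minus_mod)
  have hom: "?f \<in> hom ?Z (G\<lparr>carrier := powers y\<rparr>)"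
    using f mod assms(2) by (auto simp: hom_def int_pow_mult)
  have "bij_betw ?f (carrier ?Z) (powers y)"
  proof (rule bij_betw_imageI)
    show "inj_on ?f (carrier ?Z)"
    proof (rule inj_onI)
      fix a b assume "a \<in> carrier ?Z" "b \<in> carrier ?Z" "y [^] a = y [^] b"
      then have "a mod int (ord y) = b mod int (ord y)"
        using int_pow_eq[OF assms(2)] by (metis mod_eq_dvd_iff)
      then show "a = b"
        using \<open>a \<in> carrier ?Z\<close> \<open>b \<in> carrier ?Z\<close> pos by (simp add: carrier_integer_mod_group)
    qed
    show "?f ` carrier ?Z = powers y"
    proof
      show "powers y \<subseteq> ?f ` carrier ?Z"
      proof
        fix x assume "x \<in> powers y"
        then obtain k :: nat where "x = ?f (int k)" by (auto simp: powers_def int_pow_int)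
        then have "x = ?f (int k mod int (ord y))" using mod by simp
        then show "x \<in> ?f ` carrier ?Z" using pos by (auto simp: carrier_integer_mod_group)
      qed
    qed (use f in blast)
  qed
  then have "?Z \<cong> G\<lparr>carrier := powers y\<rparr>"
    using hom by (auto simp: is_iso_def iso_def)
  then show ?thesis by (rule group.iso_sym[OF group_integer_mod_group])
qed

section \<open>Normal complements and the case of equality\<close>

context p_m_group
begin

text \<open>On every coset fixed by \<open>u\<close>, the cocycle is \<open>u\<close> itself by
  \<open>prime_order_conj_eq\<close>, so \<open>V u\<close> is \<open>card F * l u\<close> modulo
  \<open>p ^ n\<close>. This is nonzero, which makes \<open>V y\<close> a unit; the kernel of the
  transfer is the complement.\<close>

theorem normal_complement:
  assumes "n = Suc j" "num j = p ^ j * m"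
  shows "\<exists>H K. internal_semidirect_product G H K \<and> card H = m \<and>
    G\<lparr>carrier := K\<rparr> \<cong> integer_mod_group (p ^ n)"
proof -
  obtain y where y: "y \<in> carrier G" "ord y = p ^ n" using exists_ord_top[OF assms] by blast
  define P where "P = powers y"
  \<comment> \<open>A discrete logarithm to base \<open>y\<close>; the exponent chosen is determined
    only modulo \<open>p ^ n\<close>.\<close>
  define l where "l x = (SOME k::int. y [^] k = x)" for x
  have P: "subgroup P G" using subgroup_powers[OF finite y(1)] by (simp add: P_def)
  have PG: "P \<subseteq> carrier G" using subgroup.subset[OF P] .
  have l: "y [^] l x = x" if "x \<in> P" for x
  proof -
    have "\<exists>k::int. y [^] k = x" using that by (auto simp: P_def powers_def simp flip: int_pow_int)
    then show ?thesis unfolding l_def by (rule someI_ex)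
  qed
  have y_cong: "y [^] a = y [^] b \<longleftrightarrow> [a = b] (mod int (p ^ n))" for a b :: int
    using int_pow_eq[OF y(1)] y(2) by (simp add: cong_iff_dvd_diff dvd_diff_commute)
  interpret T: transfer G P l "int (p ^ n)"
  proof (intro transfer.intro transfer_axioms.intro is_group finite P)
    fix a b assume ab: "a \<in> P" "b \<in> P"
    then have "y [^] l (a \<otimes> b) = y [^] (l a + l b)"
      using l subgroup.m_closed[OF P] y(1) by (simp add: int_pow_mult)
    then show "[l (a \<otimes> b) = l a + l b] (mod int (p ^ n))" using y_cong by simp
  qed
  define u where "u = y [^] (p ^ j)"
  have uP: "u \<in> P" by (simp add: u_def P_def powers_def)
  then have uG: "u \<in> carrier G" using PG by blast
  have ord_u: "ord u = p"
    using assms y prime_gt_0_nat[OF prime] by (simp add: u_def ord_pow_gen gcd_nat.absorb2)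
  then have u_p: "u [^] p = \<one>" using pow_ord_eq_1[OF uG] by simp
  define F where "F = {X \<in> rcosets P. X #> u = X}"
  \<comment> \<open>The number of fixed cosets is congruent modulo \<open>p\<close> to the index of
    \<open>P\<close>, which is \<open>m\<close>.\<close>
  have "\<not> p dvd card F"
  proof -
    have "[card (rcosets P) = card F] (mod p)"
      unfolding F_def
    proof (rule card_fixed_cong_prime_period[OF prime finite_rcosets[OF finite P]])
      show "(\<lambda>X. X #> u) \<in> rcosets P \<rightarrow> rcosets P"
        using rcosets_r_coset_closed[OF P] uG by blast
      show "((\<lambda>X. X #> u) ^^ p) X = X" if "X \<in> rcosets P" for X
        using funpow_r_coset rcosets_subset_carrier[OF P that] uG u_p by simp
    qed
    moreover have "card (rcosets P) = m"
      using lagrange[OF P] order card_powers[OF finite y(1)] y(2) prime_gt_0_nat[OF prime]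
      by (simp add: P_def)
    ultimately show ?thesis using coprime cong_dvd_iff by blast
  qed
  have "T.rep X \<otimes> u \<otimes> inv (T.rep X) = u" if "X \<in> F" for X
  proof -
    have X: "X \<in> rcosets P" "X #> u = X" using that by (auto simp: F_def)
    have "T.rep X \<otimes> u \<otimes> inv (T.rep X) \<in> P"
      using r_coset_fixed_iff[OF P T.rep(1)[OF X(1)] uG] T.rep(2)[OF X(1)] X(2) by simp
    then show ?thesis
      using prime_order_conj_eq[OF assms y _ ord_u T.rep(1)[OF X(1)]] uP by (simp add: P_def)
  qed
  then have Vu: "[T.V u = int (card F) * l u] (mod int (p ^ n))"
    using T.V_prime_order[OF prime uG u_p] by (simp add: F_def[symmetric])
  \<comment> \<open>Since \<open>u = y [^] (p ^ j)\<close>, a factor \<open>p\<close> in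
    \<open>V y\<close> would make \<open>V u\<close> vanish modulo \<open>p ^ n\<close>, forcing
    \<open>u = \<one>\<close>.\<close>
  have "\<not> int p dvd T.V y"
  proof
    assume "int p dvd T.V y"
    then have "int (p ^ j) * int p dvd int (p ^ j) * T.V y" by (rule mult_dvd_mono[OF dvd_refl])
    then have "int (p ^ n) dvd int (p ^ j) * T.V y" using assms(1) by (simp add: mult.commute)
    then have "[T.V u = 0] (mod int (p ^ n))"
      using T.V_pow[OF y(1), of "p ^ j"] unfolding u_def cong_0_iff[symmetric] by (rule cong_trans[rotated])
    then have "int (p ^ n) dvd int (card F) * l u"
      using Vu by (metis cong_0_iff cong_sym cong_trans)
    moreover have "Rings.coprime (int (p ^ n)) (int (card F))"
      using prime_imp_coprime[OF prime \<open>\<not> p dvd card F\<close>] by simp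
    ultimately have "int (p ^ n) dvd l u" by (simp add: coprime_dvd_mult_right_iff)
    then have "[l u = 0] (mod int (p ^ n))" by (simp add: cong_0_iff)
    then have "y [^] l u = y [^] (0::int)" using y_cong by blast
    then have "u = \<one>" using l[OF uP] by simp
    then show False using ord_u prime by auto
  qed
  then have cop: "Rings.coprime (T.V y) (int (p ^ n))"
    using prime by (simp add: coprime_commute prime_imp_coprime)
  define \<phi> where "\<phi> g = T.V g mod int (p ^ n)" for g
  let ?Z = "integer_mod_group (p ^ n)"
  have pn: "p ^ n > 0" using prime_gt_0_nat[OF prime] by simp
  interpret \<phi>: group_hom G ?Z \<phi>
  proof (intro group_hom.intro group_hom_axioms.intro is_group group_integer_mod_group)
    show "\<phi> \<in> hom G ?Z"
    proof (rule homI)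
      show "\<phi> g \<in> carrier ?Z" for g using pn by (simp add: \<phi>_def carrier_integer_mod_group)
      show "\<phi> (g \<otimes> h) = \<phi> g \<otimes>\<^bsub>?Z\<^esub> \<phi> h" if "g \<in> carrier G" "h \<in> carrier G" for g h
        using T.V_mult[OF that] by (simp add: \<phi>_def cong_def mod_add_eq)
    qed
  qed
  define H where "H = kernel G ?Z \<phi>"
  have H_iff: "g \<in> H \<longleftrightarrow> g \<in> carrier G \<and> [T.V g = 0] (mod int (p ^ n))" for g
    by (auto simp: H_def kernel_def \<phi>_def cong_def)
  have normal: "H \<lhd> G" unfolding H_def by (rule \<phi>.normal_kernel)
  then have H: "subgroup H G" by (rule normal_imp_subgroup)
  \<comment> \<open>With \<open>V y\<close> invertible, the powers of \<open>y\<close> already take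
    every value. This gives surjectivity here and the factorization
    \<open>H <#> P = carrier G\<close> below.\<close>
  have hit: "\<exists>k::nat. [T.V (y [^] k) = t] (mod int (p ^ n))" for t
  proof -
    obtain s where s: "[T.V y * s = 1] (mod int (p ^ n))"
      using cong_solve_coprime_int[OF cop] by blast
    define k where "k = nat ((s * t) mod int (p ^ n))"
    have "[int k = s * t] (mod int (p ^ n))" using pn by (simp add: k_def cong_def)
    then have "[int k * T.V y = s * t * T.V y] (mod int (p ^ n))" by (rule cong_scalar_right)
    also have "s * t * T.V y = T.V y * s * t" by (simp add: ac_simps)
    also have "[T.V y * s * t = 1 * t] (mod int (p ^ n))" using s by (rule cong_scalar_right)
    finally have "[T.V (y [^] k) = t] (mod int (p ^ n))"
      using T.V_pow[OF y(1), of k] cong_trans by (simp only: mult_1) blast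
    then show ?thesis by blast
  qed
  have "\<phi> ` carrier G = carrier ?Z"
  proof
    show "carrier ?Z \<subseteq> \<phi> ` carrier G"
    proof
      fix t assume t: "t \<in> carrier ?Z"
      obtain k :: nat where "[T.V (y [^] k) = t] (mod int (p ^ n))" using hit by blast
      moreover have "t mod int (p ^ n) = t"
        using t pn unfolding carrier_integer_mod_group by (intro mod_pos_pos_trivial) (auto split: if_splits)
      ultimately have "\<phi> (y [^] k) = t" by (simp add: \<phi>_def cong_def)
      then show "t \<in> \<phi> ` carrier G" using y(1) by blast
    qed
  qed auto
  then have "(\<lambda>X. the_elem (\<phi> ` X)) \<in> iso (G Mod H) ?Z"
    unfolding H_def by (rule \<phi>.FactGroup_iso_set)
  then have "card (carrier (G Mod H)) = card (carrier ?Z)"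
    by (auto simp: iso_def intro: bij_betw_same_card)
  then have "card (rcosets H) = p ^ n"
    unfolding card_carrier_integer_mod_group[OF pn] by (simp add: FactGroup_def)
  then have "card H = m" using lagrange[OF H] order prime_gt_0_nat[OF prime] by simp
  moreover have "H \<inter> P = {\<one>}"
  proof
    show "H \<inter> P \<subseteq> {\<one>}"
    proof
      fix x assume x: "x \<in> H \<inter> P"
      then obtain k :: nat where k: "x = y [^] k" by (auto simp: P_def powers_def)
      then have "[int k * T.V y = 0] (mod int (p ^ n))"
        using x H_iff T.V_pow[OF y(1), of k] by (metis IntD1 cong_sym cong_trans)
      then have "int (p ^ n) dvd int k"
        using cop by (simp add: cong_0_iff coprime_commute coprime_dvd_mult_left_iff)
      then have "p ^ n dvd k" using int_dvd_int_iff by blast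
      then show "x \<in> {\<one>}" using k pow_eq_id[OF y(1)] y(2) by simp
    qed
  qed (use subgroup.one_closed[OF H] subgroup.one_closed[OF P] in blast)
  moreover have "H <#> P = carrier G"
  proof
    show "H <#> P \<subseteq> carrier G" using PG subgroup.subset[OF H] by (auto simp: set_mult_def)
    show "carrier G \<subseteq> H <#> P"
    proof
      fix g assume g: "g \<in> carrier G"
      obtain k :: nat where k: "[T.V (y [^] k) = T.V g] (mod int (p ^ n))" using hit by blast
      define h where "h = g \<otimes> inv (y [^] k)"
      have h: "h \<in> carrier G" "h \<otimes> y [^] k = g" using g y(1) by (simp_all add: h_def m_assoc)
      then have "[T.V g = T.V h + T.V (y [^] k)] (mod int (p ^ n))"
        using T.V_mult[OF h(1), of "y [^] k"] y(1) by simp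
      also have "[T.V h + T.V (y [^] k) = T.V h + T.V g] (mod int (p ^ n))"
        using k by (rule cong_add[OF cong_refl])
      finally have "[T.V h = 0] (mod int (p ^ n))"
        using cong_add_rcancel[of 0 "T.V g" "T.V h"] by (simp add: cong_sym_eq)
      then have "h \<in> H" using h H_iff by blast
      moreover have "y [^] k \<in> P" by (simp add: P_def powers_def)
      ultimately show "g \<in> H <#> P" using h(2) unfolding set_mult_def by blast
    qed
  qed
  ultimately have "internal_semidirect_product G H P \<and> card H = m"
    using normal P by (simp add: internal_semidirect_product_def)
  moreover have "G\<lparr>carrier := P\<rparr> \<cong> integer_mod_group (p ^ n)"
    using powers_iso_integer_mod_group[OF finite y(1)] y(2) by (simp add: P_def)
  ultimately show ?thesis by blast
qed

text \<open>Write a solution as \<open>x = h \<otimes> k\<close>. Modulo \<open>H\<close>, its power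
  \<open>p ^ i * m\<close> shows that the same power of \<open>k\<close> lies in
  \<open>H \<inter> K\<close> and is trivial; as \<open>k\<close> has \<open>p\<close>-power order,
  \<open>k [^] (p ^ i) = \<one>\<close>. There are \<open>m\<close> choices for \<open>h\<close> and
  at most \<open>p ^ i\<close> for \<open>k\<close>, which meets the lower bound
  \<open>num_ge\<close>.\<close>

theorem num_eq_of_semidirect:
  assumes "internal_semidirect_product G H K" "card H = m"
    and "G\<lparr>carrier := K\<rparr> \<cong> integer_mod_group (p ^ n)" "i \<le> n"
  shows "num i = p ^ i * m"
proof (rule antisym[OF _ num_ge[OF assms(4)]])
  have N: "H \<lhd> G" and K: "subgroup K G" and HK: "H \<inter> K = {\<one>}" and G: "H <#> K = carrier G"
    using assms(1) by (auto simp: internal_semidirect_product_def)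
  have H: "subgroup H G" using N by (rule normal_imp_subgroup)
  interpret N: normal H G by fact
  interpret K: group "G\<lparr>carrier := K\<rparr>" using K by (rule subgroup_imp_group)
  have pn: "p ^ n > 0" using prime_gt_0_nat[OF prime] by simp
  let ?Z = "integer_mod_group (p ^ n)"
  obtain f where f: "f \<in> iso (G\<lparr>carrier := K\<rparr>) ?Z" using assms(3) by (auto simp: is_iso_def)
  have inj: "inj_on f K" and bij: "bij_betw f K (carrier ?Z)"
    using f by (auto simp: iso_def bij_betw_def)
  have f_hom: "group_hom (G\<lparr>carrier := K\<rparr>) ?Z f"
    using f by (auto simp: iso_def group_hom_def group_hom_axioms_def K.is_group)
  have cardK: "card {k \<in> K. k [^] (p ^ i) = \<one>} \<le> p ^ i"
  proof -
    have "card {k \<in> K. k [^] (p ^ i) = \<one>} = card (f ` {k \<in> K. k [^] (p ^ i) = \<one>})"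
      using inj by (intro card_image[symmetric]) (auto intro: inj_on_subset)
    also have "\<dots> \<le> card {x \<in> carrier ?Z. group.ord ?Z x dvd p ^ i}"
    proof (rule card_mono)
      show "Finite_Set.finite {x \<in> carrier ?Z. group.ord ?Z x dvd p ^ i}"
        using pn by - (rule finite_subset[of _ "carrier ?Z"], auto simp: carrier_integer_mod_group)
      show "f ` {k \<in> K. k [^] (p ^ i) = \<one>} \<subseteq> {x \<in> carrier ?Z. group.ord ?Z x dvd p ^ i}"
      proof (rule image_subsetI)
        fix k assume "k \<in> {k \<in> K. k [^] (p ^ i) = \<one>}"
        then have k: "k \<in> K" "k [^] (p ^ i) = \<one>" by auto
        have fk: "f k \<in> carrier ?Z" using bij_betwE[OF bij] k(1) by blast
        have "f k [^]\<^bsub>?Z\<^esub> (p ^ i) = f (k [^] (p ^ i))"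
          using group_hom.hom_nat_pow[OF f_hom, of k "p ^ i"] k(1) by (simp flip: nat_pow_consistent)
        also have "\<dots> = \<one>\<^bsub>?Z\<^esub>" using group_hom.hom_one[OF f_hom] k(2) by simp
        finally show "f k \<in> {x \<in> carrier ?Z. group.ord ?Z x dvd p ^ i}"
          using group.pow_eq_id[OF group_integer_mod_group fk] fk by blast
      qed
    qed
    also have "\<dots> = p ^ i"
      using pn assms(4)
      by (intro card_integer_mod_group_pow[of _ "p ^ (n - i)"]) (simp_all flip: power_add)
    finally show ?thesis .
  qed
  have "{x \<in> carrier G. ord x dvd p ^ i * m} \<subseteq> (\<lambda>(h, k). h \<otimes> k) ` (H \<times> {k \<in> K. k [^] (p ^ i) = \<one>})"
  proof
    fix x assume "x \<in> {x \<in> carrier G. ord x dvd p ^ i * m}"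
    then have x: "x \<in> carrier G" "ord x dvd p ^ i * m" by auto
    then obtain h k where hk: "h \<in> H" "k \<in> K" "x = h \<otimes> k"
      unfolding G[symmetric] set_mult_def by blast
    have hG: "h \<in> carrier G" and kG: "k \<in> carrier G"
      using hk subgroup.subset[OF H] subgroup.subset[OF K] by auto
    interpret q: group_hom G "G Mod H" "\<lambda>x. H #> x"
      using N.r_coset_hom_Mod N.factorgroup_is_group
      by (intro group_hom.intro group_hom_axioms.intro is_group)
    have "H #> x = H #> k"
      using hk hG kG subgroup.subset[OF H] coset_join2[OF hG H hk(1)] by (simp flip: coset_mult_assoc)
    then have "H #> x [^] (p ^ i * m) = H #> k [^] (p ^ i * m)"
      using q.hom_nat_pow[OF x(1)] q.hom_nat_pow[OF kG] by simp
    moreover have "x [^] (p ^ i * m) = \<one>" using pow_eq_id[OF x(1)] x(2) by simp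
    ultimately have "H #> k [^] (p ^ i * m) = H"
      using coset_mult_one[OF subgroup.subset[OF H]] by simp
    then have "k [^] (p ^ i * m) \<in> H"
      using coset_join1[OF _ _ H] kG subgroup.subset[OF H] by auto
    moreover have "k [^] (p ^ i * m) \<in> K"
      using powers_subset_subgroup[OF K hk(2)] by (auto simp: powers_def)
    ultimately have "ord k dvd p ^ i * m" using HK pow_eq_id[OF kG] by blast
    moreover have "ord k dvd p ^ n"
    proof -
      have "order (G\<lparr>carrier := K\<rparr>) = p ^ n"
        using bij_betw_same_card[OF bij] unfolding card_carrier_integer_mod_group[OF pn]
        by (simp add: order_def)
      then show ?thesis
        using K.ord_dvd_group_order[of k] hk(2) ord_subgroup[OF is_group K] by simp
    qed
    then have "Rings.coprime (ord k) m"
      using prime coprime by (metis coprime_divisors coprime_power_left_iff dvd_refl prime_imp_coprime)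
    ultimately have "ord k dvd p ^ i" by (simp add: coprime_dvd_mult_left_iff)
    then have "k [^] (p ^ i) = \<one>" using pow_eq_id[OF kG] by simp
    then show "x \<in> (\<lambda>(h, k). h \<otimes> k) ` (H \<times> {k \<in> K. k [^] (p ^ i) = \<one>})" using hk by blast
  qed
  moreover have "Finite_Set.finite (H \<times> {k \<in> K. k [^] (p ^ i) = \<one>})"
    using finite_subset[OF subgroup.subset[OF H] finite] finite_subset[OF subgroup.subset[OF K] finite]
    by simp
  ultimately have "num i \<le> card (H \<times> {k \<in> K. k [^] (p ^ i) = \<one>})"
    unfolding num_def by (rule surj_card_le[rotated])
  also have "\<dots> \<le> p ^ i * m" using cardK assms(2) by (simp add: card_cartesian_product)
  finally show "num i \<le> p ^ i * m" .
qed

theorem psi_eq_iff_semidirect: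
  "psi p G = psi p (integer_mod_group (p ^ n * m)) \<longleftrightarrow>
    (\<exists>H K. internal_semidirect_product G H K \<and> card H = m \<and>
      G\<lparr>carrier := K\<rparr> \<cong> integer_mod_group (p ^ n))"
proof
  assume eq: "psi p G = psi p (integer_mod_group (p ^ n * m))"
  show "\<exists>H K. internal_semidirect_product G H K \<and> card H = m \<and>
      G\<lparr>carrier := K\<rparr> \<cong> integer_mod_group (p ^ n)"
  proof (cases n)
    \<comment> \<open>There is no layer to use here: the complement is \<open>G\<close> itself, and
      the trivial subgroup is cyclic of order \<open>p ^ 0\<close>.\<close>
    case 0
    have "internal_semidirect_product G (carrier G) {\<one>}"
      using normal_self triv_subgroup by (auto simp: internal_semidirect_product_def set_mult_def)
    moreover have "card (carrier G) = m" using order 0 by (simp add: order_def)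
    moreover have "powers \<one> = {\<one>}" by (auto simp: powers_def)
    then have "G\<lparr>carrier := {\<one>}\<rparr> \<cong> integer_mod_group (p ^ n)"
      using powers_iso_integer_mod_group[OF finite one_closed] 0 by simp
    ultimately show ?thesis by blast
  next
    case (Suc j)
    then have "num j = p ^ j * m" using eq psi_eq_iff by simp
    then show ?thesis using normal_complement Suc by blast
  qed
next
  assume "\<exists>H K. internal_semidirect_product G H K \<and> card H = m \<and>
      G\<lparr>carrier := K\<rparr> \<cong> integer_mod_group (p ^ n)"
  then show "psi p G = psi p (integer_mod_group (p ^ n * m))"
    using psi_eq_iff num_eq_of_semidirect by auto
qed

end

theorem theorem1p1:
  fixes G :: "('a, 'b) monoid_scheme" and p n m :: nat
  assumes "Factorial_Ring.prime p" and "m \<ge> 1" and "\<not> p dvd m"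
    and "group G" and "finite (carrier G)" and "order G = p ^ n * m"
  shows "psi p G \<le> psi p (integer_mod_group (p ^ n * m)) \<and>
    (psi p G = psi p (integer_mod_group (p ^ n * m)) \<longleftrightarrow>
      (\<exists>H K. internal_semidirect_product G H K \<and> card H = m \<and>
         G\<lparr>carrier := K\<rparr> \<cong> integer_mod_group (p ^ n)))"
proof -
  interpret p_m_group G p n m
    using assms by (intro p_m_group.intro p_m_group_axioms.intro)
  show ?thesis using psi_le psi_eq_iff_semidirect by blast
qed

end
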